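(* Let $(r,s)\in\{(3,1),(3,2),(3,7),(3,11)\}$. Then 1. the Lie algebra $\mathcal N_{r+4k,s+4k}$ is not isomorphic to $\mathcal N_{s+4k,r+4k}$ for any $k=0,1,2,\dots$; 2. the Lie algebra $\mathcal N_{r,s+8k}$ is not isomorphic to $\mathcal N_{s+8k,r}$ for any $k=0,1,2,\dots$; 3. the Lie algebra $\mathcal N_{r+8k,s}$ is not isomorphic to $\mathcal N_{s,r+8k}$ for any $k=0,1,2,\dots$.
   Context: $\mathbb R^{r,s}$ denotes $\mathbb R^{r+s}$ with the symmetric bilinear form $\langle x,y\rangle_{r,s}=\sum_{i=1}^r x_iy_i-\sum_{j=1}^s x_{r+j}y_{r+j}$, and $\mathrm{Cl}_{r,s}$ is the Clifford algebra it generates with the convention $x\otimes x=-\langle x,x\rangle_{r,s}$. A $\mathrm{Cl}_{r,s}$-module is a finite-dimensional real vector space $U$ with a linear map $J\colon\mathbb R^{r,s}\to\mathrm{End}(U)$ such that $J_z^2=-\langle z,z\rangle_{r,s}\mathrm{Id}_U$. It is admissible if equipped with a non-degenerate symmetric bilinear form $\langle\cdot,\cdot\rangle_U$ with $\langle J_zx,y\rangle_U+\langle x,J_zy\rangle_U=0$ for all $z,x,y$; minimal admissible (denoted $V^{r,s}$) means (nonzero) admissible of the smallest possible dimension. $\mathcal N_{r,s}(U)=U\oplus\mathbb R^{r,s}$ is the 2-step nilpotent Lie algebra with centre $\mathbb R^{r,s}$ and bracket $[U,U]\subset\mathbb R^{r,s}$ given by $\langle J_zx,y\rangle_U=\langle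 z,[x,y]\rangle_{r,s}$. One writes $\mathcal N_{r,s}=\mathcal N_{r,s}(V^{r,s})$; up to isomorphism this does not depend on the choice of the minimal admissible module.
   Formalization: In item 3 the case r+8k = s, which occurs only for (r,s) = (3,11) and k = 1, is excluded, because there the claim would say that N_{11,11} is not isomorphic to itself. *)

theory Defs
  imports "HOL-Analysis.Analysis" "HOL-Library.Function_Algebras"
begin

instantiation "fun" :: (type, real_vector) real_vector
begin

definition scaleR_fun :: "real \<Rightarrow> ('a \<Rightarrow> 'b) \<Rightarrow> 'a \<Rightarrow> 'b"
  where "scaleR_fun c f = (\<lambda>i. c *\<^sub>R f i)"

instance
  by standard (auto simp: scaleR_fun_def fun_eq_iff algebra_simps)

end

definition linear_map_on :: "'a::real_vector set \<Rightarrow> ('a \<Rightarrow> 'b::real_vector) \<Rightarrow> bool"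
  where "linear_map_on U f \<longleftrightarrow>
    (\<forall>x\<in>U. \<forall>y\<in>U. f (x + y) = f x + f y) \<and>
    (\<forall>c. \<forall>x\<in>U. f (c *\<^sub>R x) = c *\<^sub>R f x)"

definition bilinear_on :: "'a::real_vector set \<Rightarrow> ('a \<Rightarrow> 'a \<Rightarrow> 'b::real_vector) \<Rightarrow> bool"
  where "bilinear_on U B \<longleftrightarrow>
    (\<forall>x\<in>U. linear_map_on U (B x)) \<and> (\<forall>y\<in>U. linear_map_on U (\<lambda>x. B x y))"

(* R^{r,s}: the coordinates x_1, ..., x_{r+s} are z 0, ..., z (r + s - 1); sequences vanishing
   from index r + s on are used so that r and s may vary inside formulas. *)
definition pseudo_space :: "nat \<Rightarrow> nat \<Rightarrow> (nat \<Rightarrow> real) set"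
  where "pseudo_space r s = {z. \<forall>i\<ge>r + s. z i = 0}"

definition pseudo_form :: "nat \<Rightarrow> nat \<Rightarrow> (nat \<Rightarrow> real) \<Rightarrow> (nat \<Rightarrow> real) \<Rightarrow> real"
  where "pseudo_form r s x y = (\<Sum>i<r. x i * y i) - (\<Sum>j<s. x (r + j) * y (r + j))"

(* A module with a bilinear form; its underlying space is a subspace of the ambient type. *)
record 'u form_module =
  mod_space :: "'u set"
  cl_act :: "(nat \<Rightarrow> real) \<Rightarrow> 'u \<Rightarrow> 'u"
  mod_form :: "'u \<Rightarrow> 'u \<Rightarrow> real"

definition clifford_module ::
    "nat \<Rightarrow> nat \<Rightarrow> 'u::real_vector set \<Rightarrow> ((nat \<Rightarrow> real) \<Rightarrow> 'u \<Rightarrow> 'u) \<Rightarrow> bool"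
  where "clifford_module r s U J \<longleftrightarrow>
    subspace U \<and> (\<exists>S. finite S \<and> U = span S) \<and>
    (\<forall>z\<in>pseudo_space r s. J z ` U \<subseteq> U \<and> linear_map_on U (J z)) \<and>
    (\<forall>x\<in>U. linear_map_on (pseudo_space r s) (\<lambda>z. J z x)) \<and>
    (\<forall>z\<in>pseudo_space r s. \<forall>x\<in>U. J z (J z x) = - pseudo_form r s z z *\<^sub>R x)"

definition admissible :: "nat \<Rightarrow> nat \<Rightarrow> 'u::real_vector form_module \<Rightarrow> bool"
  where "admissible r s M \<longleftrightarrow>
    (let U = mod_space M; J = cl_act M; B = mod_form M in
      clifford_module r s U J \<and>
      bilinear_on U B \<and>
      (\<forall>x\<in>U. \<forall>y\<in>U. B x y = B y x) \<and>
      (\<forall>x\<in>U. (\<forall>y\<in>U. B x y = 0) \<longrightarrow> x = 0) \<and>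
      (\<forall>z\<in>pseudo_space r s. \<forall>x\<in>U. \<forall>y\<in>U. B (J z x) y + B x (J z y) = 0))"

(* It suffices to compare with modules inside the same ambient type: any module of dimension
   smaller than that of M is isomorphic to one carried by a subspace of mod_space M. *)
definition minimal_admissible :: "nat \<Rightarrow> nat \<Rightarrow> 'u::real_vector form_module \<Rightarrow> bool"
  where "minimal_admissible r s M \<longleftrightarrow>
    admissible r s M \<and> mod_space M \<noteq> {0} \<and>
    (\<forall>M' :: 'u form_module. admissible r s M' \<and> mod_space M' \<noteq> {0} \<longrightarrow>
       dim (mod_space M) \<le> dim (mod_space M'))"

record 'a lie_alg =
  lie_space :: "'a set"
  lie_bracket :: "'a \<Rightarrow> 'a \<Rightarrow> 'a"

definition lie_algebra :: "'a::real_vector lie_alg \<Rightarrow> bool"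
  where "lie_algebra L \<longleftrightarrow>
    (let A = lie_space L; b = lie_bracket L in
      subspace A \<and> (\<forall>x\<in>A. \<forall>y\<in>A. b x y \<in> A) \<and> bilinear_on A b \<and>
      (\<forall>x\<in>A. b x x = 0) \<and>
      (\<forall>x\<in>A. \<forall>y\<in>A. \<forall>z\<in>A. b x (b y z) + b y (b z x) + b z (b x y) = 0))"

definition lie_isomorphic :: "'a::real_vector lie_alg \<Rightarrow> 'b::real_vector lie_alg \<Rightarrow> bool"
  where "lie_isomorphic L L' \<longleftrightarrow>
    (\<exists>\<phi>. linear_map_on (lie_space L) \<phi> \<and> bij_betw \<phi> (lie_space L) (lie_space L') \<and>
       (\<forall>x\<in>lie_space L. \<forall>y\<in>lie_space L.
          \<phi> (lie_bracket L x y) = lie_bracket L' (\<phi> x) (\<phi> y)))"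

definition centre_bracket ::
    "nat \<Rightarrow> nat \<Rightarrow> 'u::real_vector form_module \<Rightarrow> 'u \<Rightarrow> 'u \<Rightarrow> nat \<Rightarrow> real"
  where "centre_bracket r s M x y =
    (THE w. w \<in> pseudo_space r s \<and>
       (\<forall>z\<in>pseudo_space r s. mod_form M (cl_act M z x) y = pseudo_form r s z w))"

definition pseudo_H_type ::
    "nat \<Rightarrow> nat \<Rightarrow> 'u::real_vector form_module \<Rightarrow> ('u \<times> (nat \<Rightarrow> real)) lie_alg"
  where "pseudo_H_type r s M =
    \<lparr>lie_space = mod_space M \<times> pseudo_space r s,
     lie_bracket = (\<lambda>p q. (0, centre_bracket r s M (fst p) (fst q)))\<rparr>"

lemma subspace_pseudo_space: "subspace (pseudo_space r s)"
  by (auto simp: subspace_def pseudo_space_def scaleR_fun_def)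

lemma linear_map_on_sum:
  assumes "subspace U" "linear_map_on U f" "finite I" "\<And>i. i \<in> I \<Longrightarrow> g i \<in> U"
  shows "f (\<Sum>i\<in>I. c i *\<^sub>R g i) = (\<Sum>i\<in>I. c i *\<^sub>R f (g i))"
  using assms(3,4)
proof (induction I)
  case empty
  have "f (0 *\<^sub>R 0) = 0 *\<^sub>R f 0"
    using assms(1,2) unfolding linear_map_on_def by (meson subspace_0)
  then show ?case by simp
next
  case (insert a I)
  have "(\<Sum>i\<in>I. c i *\<^sub>R g i) \<in> U" "g a \<in> U" "c a *\<^sub>R g a \<in> U"
    using insert assms(1) by (auto intro!: subspace_sum subspace_scale)
  then have "f (c a *\<^sub>R g a + (\<Sum>i\<in>I. c i *\<^sub>R g i)) = c a *\<^sub>R f (g a) + f (\<Sum>i\<in>I. c i *\<^sub>R g i)"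
    using assms(2) by (simp add: linear_map_on_def)
  then show ?case using insert by simp
qed

lemma pseudo_form_basis:
  "pseudo_form r s (\<lambda>j. if j = i then 1 else 0) w =
    (if i < r then w i else if i < r + s then - w i else 0)"
proof -
  have "(\<Sum>j<s. (if r + j = i then 1 else 0) * w (r + j)) = (if r \<le> i \<and> i < r + s then w i else 0)"
  proof (cases "r \<le> i")
    case True
    then have "(\<Sum>j<s. (if r + j = i then 1 else 0) * w (r + j)) =
        (\<Sum>j<s. if j = i - r then w i else 0)"
      by (intro sum.cong) auto
    then show ?thesis using True by auto
  qed (auto intro!: sum.neutral)
  moreover have "(\<Sum>j<r. (if j = i then 1 else 0) * w j) = (if i < r then w i else 0)"
    by (simp add: if_distrib[of "\<lambda>c. c * _"] cong: if_cong)
  ultimately show ?thesis by (auto simp: pseudo_form_def)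
qed

lemma pseudo_form_represents:
  assumes f: "linear_map_on (pseudo_space r s) f"
  shows "\<exists>!w. w \<in> pseudo_space r s \<and> (\<forall>z\<in>pseudo_space r s. f z = pseudo_form r s z w)"
proof -
  define e :: "nat \<Rightarrow> nat \<Rightarrow> real" where "e i = (\<lambda>j. if j = i then 1 else 0)" for i
  have e: "e i \<in> pseudo_space r s" if "i < r + s" for i
    using that by (auto simp: e_def pseudo_space_def)
  define w where "w i = (if i < r then f (e i) else if i < r + s then - f (e i) else 0)" for i
  have w: "w \<in> pseudo_space r s" by (auto simp: w_def pseudo_space_def)
  have split: "(\<Sum>i<r + s. h i) = (\<Sum>i<r. h i) + (\<Sum>j<s. h (r + j))" for h :: "nat \<Rightarrow> real"
    by (induction s) auto
  have rep: "f z = pseudo_form r s z w" if z: "z \<in> pseudo_space r s" for z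
  proof -
    have sum_app: "(\<Sum>i<n. z i *\<^sub>R e i) j = (\<Sum>i<n. z i * e i j)" for n :: nat and j
      by (induction n) (auto simp: scaleR_fun_def)
    have "z = (\<Sum>i<r + s. z i *\<^sub>R e i)"
    proof
      fix j
      have "(\<Sum>i<r + s. z i * e i j) = (\<Sum>i<r + s. if i = j then z j else 0)"
        by (intro sum.cong) (auto simp: e_def)
      also have "\<dots> = z j" using z by (auto simp: pseudo_space_def)
      finally show "z j = (\<Sum>i<r + s. z i *\<^sub>R e i) j" by (simp add: sum_app)
    qed
    then have "f z = (\<Sum>i<r + s. z i *\<^sub>R f (e i))"
      using linear_map_on_sum[OF subspace_pseudo_space f, of "{..<r + s}" e z] e by simp
    then show ?thesis by (simp add: split pseudo_form_def w_def sum_negf)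
  qed
  show ?thesis
  proof (rule ex1I[of _ w])
    fix v assume v: "v \<in> pseudo_space r s \<and> (\<forall>z\<in>pseudo_space r s. f z = pseudo_form r s z v)"
    have "v i = w i" for i
    proof (cases "i < r + s")
      case True
      then have "pseudo_form r s (e i) v = pseudo_form r s (e i) w"
        using v rep e by metis
      then show ?thesis using True by (auto simp: e_def pseudo_form_basis split: if_splits)
    next
      case False
      then show ?thesis using v w by (auto simp: pseudo_space_def)
    qed
    then show "v = w" by auto
  qed (use w rep in auto)
qed

lemma admissible_functional:
  assumes "admissible r s M" "x \<in> mod_space M" "y \<in> mod_space M"
  shows "linear_map_on (pseudo_space r s) (\<lambda>z. mod_form M (cl_act M z x) y)"
proof -
  have "clifford_module r s (mod_space M) (cl_act M)" and B: "bilinear_on (mod_space M) (mod_form M)"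
    using assms(1) by (auto simp: admissible_def Let_def)
  then have "linear_map_on (pseudo_space r s) (\<lambda>z. cl_act M z x)"
    and "\<And>z. z \<in> pseudo_space r s \<Longrightarrow> cl_act M z x \<in> mod_space M"
    using assms(2) by (auto simp: clifford_module_def)
  moreover have "linear_map_on (mod_space M) (\<lambda>x. mod_form M x y)"
    using B assms(3) by (auto simp: bilinear_on_def)
  ultimately show ?thesis
    by (simp add: linear_map_on_def)
qed

lemma centre_bracket:
  assumes "admissible r s M" "x \<in> mod_space M" "y \<in> mod_space M"
  shows "centre_bracket r s M x y \<in> pseudo_space r s"
    and "z \<in> pseudo_space r s \<Longrightarrow>
      mod_form M (cl_act M z x) y = pseudo_form r s z (centre_bracket r s M x y)"
  using theI'[OF pseudo_form_represents[OF admissible_functional[OF assms]]]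
  by (auto simp: centre_bracket_def)

lemma centre_bracket_eqI:
  assumes "admissible r s M" "x \<in> mod_space M" "y \<in> mod_space M" "w \<in> pseudo_space r s"
    and "\<And>z. z \<in> pseudo_space r s \<Longrightarrow> mod_form M (cl_act M z x) y = pseudo_form r s z w"
  shows "centre_bracket r s M x y = w"
  using pseudo_form_represents[OF admissible_functional[OF assms(1-3)]] centre_bracket[OF assms(1-3)]
    assms(4,5) by metis

lemma pseudo_form_add: "pseudo_form r s z (v + w) = pseudo_form r s z v + pseudo_form r s z w"
  by (simp add: pseudo_form_def sum.distrib algebra_simps)

lemma pseudo_form_scale: "pseudo_form r s z (c *\<^sub>R w) = c * pseudo_form r s z w"
  by (simp add: pseudo_form_def scaleR_fun_def sum_distrib_left algebra_simps)

lemma lie_algebra_pseudo_H_type: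
  assumes M: "admissible r s M"
  shows "lie_algebra (pseudo_H_type r s M)"
proof -
  let ?U = "mod_space M" and ?Z = "pseudo_space r s" and ?b = "centre_bracket r s M"
  have U: "subspace ?U" and B: "bilinear_on ?U (mod_form M)"
    and J: "\<And>z x. z \<in> ?Z \<Longrightarrow> x \<in> ?U \<Longrightarrow> cl_act M z x \<in> ?U"
    and Jl: "\<And>z. z \<in> ?Z \<Longrightarrow> linear_map_on ?U (cl_act M z)"
    and sym: "\<And>x y. x \<in> ?U \<Longrightarrow> y \<in> ?U \<Longrightarrow> mod_form M x y = mod_form M y x"
    and skew: "\<And>z x y. z \<in> ?Z \<Longrightarrow> x \<in> ?U \<Longrightarrow> y \<in> ?U \<Longrightarrow>
      mod_form M (cl_act M z x) y + mod_form M x (cl_act M z y) = 0"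
    using M by (auto simp: admissible_def clifford_module_def Let_def)
  note Zc = subspace_add[OF subspace_pseudo_space] subspace_scale[OF subspace_pseudo_space]
    subspace_0[OF subspace_pseudo_space]
  note Uc = subspace_add[OF U] subspace_scale[OF U] subspace_0[OF U]
  note b = centre_bracket[OF M]
  have right: "linear_map_on ?U (?b x)" if "x \<in> ?U" for x
    unfolding linear_map_on_def
    by (intro conjI allI ballI; rule centre_bracket_eqI[OF M])
      (use that B J b in \<open>auto intro!: Uc Zc simp: pseudo_form_add pseudo_form_scale
        bilinear_on_def linear_map_on_def simp flip: b(2)\<close>)
  have left: "linear_map_on ?U (\<lambda>x. ?b x y)" if "y \<in> ?U" for y
    unfolding linear_map_on_def
    by (intro conjI allI ballI; rule centre_bracket_eqI[OF M])
      (use that B J Jl b in \<open>auto intro!: Uc Zc simp: pseudo_form_add pseudo_form_scale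
        bilinear_on_def linear_map_on_def simp flip: b(2)\<close>)
  have alt: "?b x x = 0" if x: "x \<in> ?U" for x
  proof (rule centre_bracket_eqI[OF M x x Zc(3)])
    fix z assume z: "z \<in> ?Z"
    have "mod_form M (cl_act M z x) x = 0"
      using skew[OF z x x] sym[OF x J[OF z x]] by simp
    then show "mod_form M (cl_act M z x) x = pseudo_form r s z 0"
      by (simp add: pseudo_form_def)
  qed
  have zero: "?b x 0 = 0" if "x \<in> ?U" for x
    using right[OF that] Uc(3) unfolding linear_map_on_def by (metis scaleR_zero_left)
  have "subspace (?U \<times> ?Z)" by (rule subspace_Times[OF U subspace_pseudo_space])
  then show ?thesis
    using left right alt zero b(1) Uc(3) unfolding lie_algebra_def pseudo_H_type_def
    by (auto simp: bilinear_on_def linear_map_on_def zero_prod_def)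
qed

end

theory Submission
  imports Defs
begin

text \<open>In all cases the first index \<open>r\<close> is congruent to 3 modulo 4 and \<open>r \<noteq> s\<close>; nothing else about
  \<open>(r, s)\<close> matters apart from \<open>s > 0\<close>. Let \<open>p\<close> be the product of the \<open>J\<^sub>i\<close> over the \<open>r\<close> positive
  directions. Since \<open>r\<close> is 3 modulo 4, the form \<open>H x y = \<langle>p x, y\<rangle>\<close> is symmetric and every \<open>J\<^sub>i\<close> is
  an isometry of \<open>H\<close>. Diagonalising \<open>H\<close> with respect to a \<open>J\<close>-invariant inner product splits the
  module into non-degenerate submodules, so on a minimal admissible module \<open>H\<close> is definite.

  An isomorphism with the algebra of signature \<open>(s, r)\<close> yields bijections \<open>A\<close> of the modules and \<open>G\<close>
  of the centres with \<open>\<langle>J' (G z) A x, A y\<rangle>' = \<langle>J z x, y\<rangle>\<close>. Comparing null cones, \<open>G\<close> multiplies the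
  quadratic form by a constant \<open>c\<close>, which is negative by Sylvester's law because \<open>r \<noteq> s\<close>. Even
  products of the \<open>J\<^sub>i\<close> are intertwined by \<open>A\<close> up to powers of \<open>c\<close>, so \<open>H\<close> is carried to a multiple
  of the form \<open>H'\<close> built from the \<open>J' (G e\<^sub>i)\<close>. But \<open>J' (G e\<^sub>0)\<close> multiplies \<open>H'\<close> by \<open>c < 0\<close>,
  contradicting definiteness.\<close>

subsection \<open>Linear algebra on subspaces\<close>

text \<open>Gaussian elimination, by induction on the equations. It later supplies vectors with
  prescribed vanishing coordinates for the law of inertia.\<close>

lemma homogeneous_system_nontrivial:
  fixes a :: "'i \<Rightarrow> 'j \<Rightarrow> real"
  assumes "finite I" "finite J" "card I < card J"
  shows "\<exists>z. (\<exists>j\<in>J. z j \<noteq> 0) \<and> (\<forall>i\<in>I. (\<Sum>j\<in>J. a i j * z j) = 0)"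
  using assms
proof (induction I arbitrary: J a)
  case empty
  then obtain j where "j \<in> J" by (metis card.empty card_gt_0_iff ex_in_conv)
  then show ?case by (intro exI[of _ "\<lambda>_. 1"]) auto
next
  case (insert i0 I)
  show ?case
  proof (cases "\<exists>j\<in>J. a i0 j \<noteq> 0")
    case False
    obtain z where "\<exists>j\<in>J. z j \<noteq> 0" "\<forall>i\<in>I. (\<Sum>j\<in>J. a i j * z j) = 0"
      using insert.IH[of J a] insert.prems insert.hyps by auto
    then show ?thesis using False by (intro exI[of _ z]) auto
  next
    case True
    then obtain j0 where j0: "j0 \<in> J" "a i0 j0 \<noteq> 0" by auto
    define J' where "J' = J - {j0}"
    \<comment> \<open>Coefficients left after equation \<open>i0\<close> has eliminated the unknown
      \<open>j0\<close>; \<open>t\<close> below is the value of that unknown recovered by back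
      substitution.\<close>
    define a' where "a' i j = a i j - a i j0 * a i0 j / a i0 j0" for i j
    have J': "finite J'" "J = insert j0 J'" "j0 \<notin> J'" using j0 insert.prems by (auto simp: J'_def)
    have "card I < card J'" using insert.prems insert.hyps J' by auto
    then obtain z where z: "\<exists>j\<in>J'. z j \<noteq> 0" "\<forall>i\<in>I. (\<Sum>j\<in>J'. a' i j * z j) = 0"
      using insert.IH[of J' a'] J' by auto
    define t where "t = - (\<Sum>j\<in>J'. a i0 j * z j) / a i0 j0"
    define z' where "z' = z(j0 := t)"
    have sum: "(\<Sum>j\<in>J. a i j * z' j) = a i j0 * t + (\<Sum>j\<in>J'. a i j * z j)" for i
    proof -
      have "(\<Sum>j\<in>J'. a i j * z' j) = (\<Sum>j\<in>J'. a i j * z j)"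
        using J' by (intro sum.cong) (auto simp: z'_def)
      then show ?thesis using J' by (simp add: z'_def)
    qed
    have "(\<Sum>j\<in>J'. a' i j * z j) = (\<Sum>j\<in>J'. a i j * z j) + a i j0 * t" for i
    proof -
      have "(\<Sum>j\<in>J'. a' i j * z j) = (\<Sum>j\<in>J'. a i j * z j - a i j0 / a i0 j0 * (a i0 j * z j))"
        by (intro sum.cong) (auto simp: a'_def left_diff_distrib)
      also have "\<dots> = (\<Sum>j\<in>J'. a i j * z j) - a i j0 / a i0 j0 * (\<Sum>j\<in>J'. a i0 j * z j)"
        by (simp only: sum_subtractf sum_distrib_left)
      finally show ?thesis by (simp add: t_def)
    qed
    then have "\<forall>i\<in>I. (\<Sum>j\<in>J. a i j * z' j) = 0" using z sum by (auto simp: algebra_simps)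
    moreover have "(\<Sum>j\<in>J. a i0 j * z' j) = 0" using sum j0 by (simp add: t_def)
    moreover have "\<exists>j\<in>J. z' j \<noteq> 0" using z J' by (auto simp: z'_def)
    ultimately show ?thesis by auto
  qed
qed

text \<open>A basis of \<open>W\<close> extends to a basis of \<open>U\<close>, and the dimensions
  leave no room for further vectors. This turns minimality of dimension into equality of
  submodules.\<close>

lemma subspace_eqI_dim:
  fixes W :: "'a::real_vector set"
  assumes W: "subspace W" "W \<subseteq> U" and U: "finite S" "U = span S" and "dim U \<le> dim W"
  shows "W = U"
proof -
  obtain C where C: "C \<subseteq> W" "independent C" "W \<subseteq> span C" "card C = dim W"
    using basis_exists by blast
  obtain D where D: "C \<subseteq> D" "D \<subseteq> U" "independent D" "U \<subseteq> span D"
    using maximal_independent_subset_extend[of C U] C W by blast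
  have "finite D" using independent_span_bound[of S D] D U by auto
  moreover have "card D = dim U" using D by (intro basis_card_eq_dim) auto
  ultimately have "C = D" using D(1) C(4) assms(5) by (simp add: card_seteq)
  then show ?thesis using C D W by (metis span_minimal subset_antisym subset_trans)
qed

section \<open>Symmetric forms relative to an inner product\<close>

text \<open>The modules carry no topology, so the unit sphere is formed from coefficient functions.
  It is closed in the product topology and lies in a cube, which is compact by Tychonoff.\<close>

lemma compact_coordinate_sphere:
  fixes S :: "'i set"
  assumes S: "finite S"
  shows "compact {c :: 'i \<Rightarrow> real. (\<forall>i. i \<notin> S \<longrightarrow> c i = 0) \<and> (\<Sum>i\<in>S. (c i)\<^sup>2) = 1}"
proof -
  let ?X = "{c :: 'i \<Rightarrow> real. (\<forall>i. i \<notin> S \<longrightarrow> c i = 0) \<and> (\<Sum>i\<in>S. (c i)\<^sup>2) = 1}"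
  have "compactin (product_topology (\<lambda>_. euclidean) UNIV) (PiE UNIV (\<lambda>_::'i. {-1..1::real}))"
    by (simp only: compactin_PiE compactin_euclidean_iff compact_Icc simp_thms ball_UNIV HOL.all_simps)
  then have "compact (PiE UNIV (\<lambda>_::'i. {-1..1::real}))"
    by (simp only: euclidean_product_topology compactin_euclidean_iff)
  moreover have "closed ?X"
    by (intro closed_Collect_conj closed_Collect_all closed_Collect_imp closed_Collect_eq
        open_Collect_const continuous_intros continuous_on_product_coordinates)
  moreover have "?X \<subseteq> PiE UNIV (\<lambda>_. {-1..1})"
  proof
    fix c assume c: "c \<in> ?X"
    have "(c i)\<^sup>2 \<le> 1" for i
    proof (cases "i \<in> S")
      case True
      then have "(c i)\<^sup>2 \<le> (\<Sum>i\<in>S. (c i)\<^sup>2)" using S by (intro member_le_sum) auto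
      then show ?thesis using c by simp
    qed (use c in auto)
    then have "c i \<in> {-1..1}" for i by (metis abs_square_le_1 abs_le_iff atLeastAtMost_iff minus_le_iff)
    then show "c \<in> PiE UNIV (\<lambda>_. {-1..1})" by blast
  qed
  ultimately show ?thesis using compact_Int_closed[of "PiE UNIV (\<lambda>_::'i. {-1..1::real})" ?X] by (simp only: Int_absorb1)
qed

lemma bilinear_onD:
  assumes "bilinear_on U B" "x \<in> U" "z \<in> U"
  shows "B (c *\<^sub>R x) z = c *\<^sub>R B x z" "B z (c *\<^sub>R x) = c *\<^sub>R B z x"
    "y \<in> U \<Longrightarrow> B (x + y) z = B x z + B y z" "y \<in> U \<Longrightarrow> B z (x + y) = B z x + B z y"
  using assms by (auto simp: bilinear_on_def linear_map_on_def)

lemma linear_map_onD: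
  assumes "linear_map_on U f" "x \<in> U"
  shows "y \<in> U \<Longrightarrow> f (x + y) = f x + f y" "f (c *\<^sub>R x) = c *\<^sub>R f x" "f 0 = 0"
proof -
  have s: "f (c *\<^sub>R x) = c *\<^sub>R f x" for c using assms by (auto simp: linear_map_on_def)
  show "y \<in> U \<Longrightarrow> f (x + y) = f x + f y" "f (c *\<^sub>R x) = c *\<^sub>R f x"
    using assms by (auto simp: linear_map_on_def)
  show "f 0 = 0" using s[of 0] by simp
qed

text \<open>Along the line \<open>x + t *\<^sub>R y\<close> the form is a nonnegative quadratic
  polynomial in \<open>t\<close> without constant term, so its linear coefficient vanishes.\<close>

lemma psd_null_radical:
  assumes U: "subspace U" and Q: "bilinear_on U Q" and sym: "\<And>x y. x \<in> U \<Longrightarrow> y \<in> U \<Longrightarrow> Q x y = Q y x"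
    and psd: "\<And>x. x \<in> U \<Longrightarrow> Q x x \<ge> (0::real)"
    and x: "x \<in> U" "Q x x = 0" and y: "y \<in> U"
  shows "Q x y = 0"
proof -
  have "0 \<le> 2 * t * Q x y + t\<^sup>2 * Q y y" for t
  proof -
    have m: "t *\<^sub>R y \<in> U" "x + t *\<^sub>R y \<in> U" using U x y by (auto intro: subspace_add subspace_scale)
    have "Q (x + t *\<^sub>R y) (x + t *\<^sub>R y) = 2 * t * Q x y + t\<^sup>2 * Q y y"
      using m x y by (simp add: bilinear_onD[OF Q] sym[of y x] power2_eq_square algebra_simps)
    then show ?thesis using psd[OF m(2)] by simp
  qed
  note h = this
  \<comment> \<open>The polynomial will be evaluated at \<open>- Q x y / q\<close>; the added 1
    keeps the denominator positive even when \<open>Q y y = 0\<close>.\<close>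
  define q where "q = Q y y + 1"
  have q: "q > 0" and Qyy: "Q y y = q - 1" using psd[OF y] by (simp_all add: q_def)
  have "0 \<le> 2 * (- Q x y / q) * Q x y + (- Q x y / q)\<^sup>2 * Q y y" by (rule h)
  also have "\<dots> = - (Q x y)\<^sup>2 * (q + 1) / q\<^sup>2"
    using q by (simp add: Qyy field_simps power2_eq_square)
  finally have "(Q x y)\<^sup>2 * (q + 1) \<le> 0" using q by (simp add: divide_le_0_iff zero_le_divide_iff)
  then show ?thesis using q by (simp add: mult_le_0_iff)
qed

text \<open>The Rayleigh quotient of \<open>H\<close> with respect to \<open>K\<close> attains its maximum \<open>l\<close> on the compact
  coordinate sphere; the form \<open>l K - H\<close> is then positive semidefinite and has a null vector.\<close>

lemma symmetric_form_eigenvector: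
  fixes H K :: "'u::real_vector \<Rightarrow> 'u \<Rightarrow> real"
  assumes S: "finite S" "independent S" "U = span S" "S \<noteq> {}"
    and H: "bilinear_on U H" "\<And>x y. x \<in> U \<Longrightarrow> y \<in> U \<Longrightarrow> H x y = H y x"
    and K: "bilinear_on U K" "\<And>x y. x \<in> U \<Longrightarrow> y \<in> U \<Longrightarrow> K x y = K y x"
      "\<And>x. x \<in> U \<Longrightarrow> x \<noteq> 0 \<Longrightarrow> K x x > 0"
  shows "\<exists>l. \<exists>x\<in>U. x \<noteq> 0 \<and> (\<forall>y\<in>U. H x y = l * K x y)"
proof -
  let ?X = "{c :: 'u \<Rightarrow> real. (\<forall>i. i \<notin> S \<longrightarrow> c i = 0) \<and> (\<Sum>i\<in>S. (c i)\<^sup>2) = 1}"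
  define V where "V c = (\<Sum>b\<in>S. c b *\<^sub>R b)" for c :: "'u \<Rightarrow> real"
  have U: "subspace U" using S by simp
  have SU: "b \<in> U" if "b \<in> S" for b using that S by (simp add: span_base)
  have VU: "V c \<in> U" for c unfolding V_def using U SU by (intro subspace_sum subspace_scale) auto
  \<comment> \<open>In coordinates the form is a quadratic polynomial, which gives continuity in the
    coefficients.\<close>
  have expand: "B (V c) (V c) = (\<Sum>b\<in>S. \<Sum>b'\<in>S. c b * (c b' * B b b'))"
    if B: "bilinear_on U B" for B :: "'u \<Rightarrow> 'u \<Rightarrow> real" and c
  proof -
    have left: "linear_map_on U (\<lambda>x. B x (V c))" and right: "linear_map_on U (B b)" if "b \<in> S" for b
      using B VU SU that by (auto simp: bilinear_on_def)
    have "B (V c) (V c) = (\<Sum>b\<in>S. c b *\<^sub>R B b (V c))"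
      using linear_map_on_sum[OF U left S(1), of _ "\<lambda>b. b" c] SU S(4) unfolding V_def by blast
    also have "\<dots> = (\<Sum>b\<in>S. c b *\<^sub>R (\<Sum>b'\<in>S. c b' *\<^sub>R B b b'))"
      using linear_map_on_sum[OF U right S(1), of _ "\<lambda>b. b" c] SU unfolding V_def
      by (intro sum.cong) auto
    finally show ?thesis by (simp add: sum_distrib_left)
  qed
  have nz: "V c \<noteq> 0" if "c \<in> ?X" for c
  proof
    assume "V c = 0"
    then have "\<forall>b\<in>S. c b = 0"
      using S(1,2) unfolding V_def by (metis dependent_finite)
    then show False using that by simp
  qed
  have cont: "continuous_on ?X (\<lambda>c. B (V c) (V c))" if "bilinear_on U B" for B :: "'u \<Rightarrow> 'u \<Rightarrow> real"
    unfolding expand[OF that]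
    by (intro continuous_intros continuous_on_subset[OF continuous_on_product_coordinates subset_UNIV])
  obtain b0 where "b0 \<in> S" using S(4) by auto
  then have "(\<Sum>b\<in>S. (if b = b0 then 1 else 0 :: real)\<^sup>2) = 1"
    using S(1) by (simp add: if_distrib[of "\<lambda>t. t\<^sup>2"] cong: if_cong)
  then have "(\<lambda>b. if b = b0 then 1 else 0) \<in> ?X" using \<open>b0 \<in> S\<close> by auto
  then have ne: "?X \<noteq> {}" by (rule ex_in_conv[THEN iffD1, OF exI])
  define f where "f c = H (V c) (V c) / K (V c) (V c)" for c
  have pos: "K (V c) (V c) > 0" if "c \<in> ?X" for c by (rule K(3)[OF VU nz[OF that]])
  have "continuous_on ?X f"
    unfolding f_def
  proof (rule continuous_on_divide[OF cont[OF H(1)] cont[OF K(1)]], rule ballI)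
    show "K (V c) (V c) \<noteq> 0" if "c \<in> ?X" for c using pos[OF that] by simp
  qed
  from continuous_attains_sup[OF compact_coordinate_sphere[OF S(1)] ne this]
  obtain c0 where c0: "c0 \<in> ?X" and max: "\<forall>c\<in>?X. f c \<le> f c0"
    by (elim bexE)
  define l where "l = f c0"
  define Q where "Q x y = l * K x y - H x y" for x y
  have bQ: "bilinear_on U Q"
    using H(1) K(1) by (auto simp: Q_def bilinear_on_def linear_map_on_def algebra_simps)
  have symQ: "Q x y = Q y x" if "x \<in> U" "y \<in> U" for x y
    using that H(2) K(2) by (simp add: Q_def)
  have psd: "Q x x \<ge> 0" if x: "x \<in> U" for x
  proof (cases "x = 0")
    case True
    then show ?thesis using bilinear_onD(1)[OF bQ x x, of 0] by simp
  next
    case False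
    have "x \<in> span S" using x S by simp
    then obtain u where u: "x = (\<Sum>b\<in>S. u b *\<^sub>R b)" using span_finite[OF S(1)] by auto
    \<comment> \<open>Dividing by the Euclidean length \<open>N\<close> of the coefficients moves
      \<open>x\<close> onto the sphere, where \<open>l\<close> bounds the quotient;
      \<open>Q x x\<close> only changes by the factor \<open>N\<^sup>2\<close>.\<close>
    define N where "N = sqrt (\<Sum>b\<in>S. (u b)\<^sup>2)"
    have "\<exists>b\<in>S. u b \<noteq> 0" using False u by (metis (mono_tags, lifting) scaleR_zero_left sum.neutral)
    then have "(\<Sum>b\<in>S. (u b)\<^sup>2) > 0" using S(1) by (metis sum_pos2 zero_le_power2 zero_less_power2)
    then have N: "N > 0" "N\<^sup>2 = (\<Sum>b\<in>S. (u b)\<^sup>2)" by (simp_all add: N_def)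
    define c where "c b = (if b \<in> S then u b / N else 0)" for b
    have "(\<Sum>b\<in>S. (c b)\<^sup>2) = (\<Sum>b\<in>S. (u b)\<^sup>2) / N\<^sup>2"
      unfolding sum_divide_distrib by (intro sum.cong) (simp_all add: c_def power_divide)
    then have "(\<Sum>b\<in>S. (c b)\<^sup>2) = 1" using N by (metis divide_self less_irrefl zero_less_power)
    then have cX: "c \<in> ?X" by (simp add: c_def)
    have "x = N *\<^sub>R V c" using N by (simp add: u V_def c_def scaleR_sum_right)
    then have "Q x x = N * (N * Q (V c) (V c))" using VU U by (simp add: bilinear_onD[OF bQ] subspace_scale)
    moreover have "f c \<le> l" using max cX unfolding l_def by (rule bspec)
    then have "Q (V c) (V c) \<ge> 0" using pos[OF cX] by (simp add: Q_def f_def field_simps)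
    ultimately show ?thesis using N by simp
  qed
  \<comment> \<open>The maximum is attained at \<open>c0\<close>. A null vector of a semidefinite
    form lies in its radical, and this is the eigenvector equation.\<close>
  have "Q (V c0) (V c0) = 0" using pos[OF c0] by (simp add: Q_def l_def f_def)
  then have "Q (V c0) y = 0" if "y \<in> U" for y
    using psd_null_radical[OF U bQ symQ psd VU] that by blast
  then show ?thesis using VU[of c0] nz[OF c0] unfolding Q_def
    by (intro exI[of _ l] bexI[of _ "V c0"]) auto
qed

text \<open>The standard inner product of the coordinates in the basis \<open>S\<close>; the
  averaging over the operators \<open>J i\<close> starts from it.\<close>

lemma exists_inner_product_on_span:
  fixes S :: "'u::real_vector set"
  assumes S: "finite S" "independent S" and U: "U = span S"
  obtains K :: "'u \<Rightarrow> 'u \<Rightarrow> real" where "bilinear_on U K" "\<And>x y. K x y = K y x"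
    "\<And>x. x \<in> U \<Longrightarrow> x \<noteq> 0 \<Longrightarrow> K x x > 0"
proof
  let ?K = "\<lambda>x y. \<Sum>b\<in>S. representation S x b * representation S y b"
  show "bilinear_on U ?K"
    using S unfolding bilinear_on_def linear_map_on_def U
    by (auto simp: representation_add representation_scale sum.distrib sum_distrib_left algebra_simps)
  show "?K x y = ?K y x" for x y by (simp add: mult.commute)
  fix x assume x: "x \<in> U" "x \<noteq> 0"
  have "\<exists>b\<in>S. representation S x b \<noteq> 0"
  proof (rule ccontr)
    assume "\<not> ?thesis"
    then have "{b. representation S x b \<noteq> 0} = {}"
      using representation_ne_zero[of S x] by auto
    then show False using sum_nonzero_representation_eq[OF S(2), of x] x U by simp
  qed
  then show "?K x x > 0"
    using S(1) by (auto intro!: sum_pos2 simp flip: power2_eq_square)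
qed

subsection \<open>Anticommuting skew operators\<close>

text \<open>The product of the first \<open>m\<close> operators, with index 0 applied first. For
  \<open>m = r\<close> and the actions of the unit vectors it is the Clifford volume element of the
  positive directions.\<close>

primrec volume :: "(nat \<Rightarrow> 'u \<Rightarrow> 'u) \<Rightarrow> nat \<Rightarrow> 'u \<Rightarrow> 'u" where
  "volume J 0 x = x"
| "volume J (Suc m) x = J m (volume J m x)"

text \<open>The squares are arbitrary scalars \<open>\<sigma> i\<close> so that the same facts serve
  two families: the actions of the unit vectors, with squares 1 or -1, and the actions of their
  images under \<open>G\<close>, whose squares involve the factor \<open>c\<close>.\<close>

locale skew_system =
  fixes U :: "'u::real_vector set" and B :: "'u \<Rightarrow> 'u \<Rightarrow> real"
    and J :: "nat \<Rightarrow> 'u \<Rightarrow> 'u" and n :: nat and \<sigma> :: "nat \<Rightarrow> real"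
  assumes U: "subspace U" and B: "bilinear_on U B"
    and mem: "i < n \<Longrightarrow> x \<in> U \<Longrightarrow> J i x \<in> U"
    and lin: "i < n \<Longrightarrow> linear_map_on U (J i)"
    and anti: "i < n \<Longrightarrow> j < n \<Longrightarrow> i \<noteq> j \<Longrightarrow> x \<in> U \<Longrightarrow> J i (J j x) = - J j (J i x)"
    and sq: "i < n \<Longrightarrow> x \<in> U \<Longrightarrow> J i (J i x) = \<sigma> i *\<^sub>R x"
    and skew: "i < n \<Longrightarrow> x \<in> U \<Longrightarrow> y \<in> U \<Longrightarrow> B (J i x) y = - B x (J i y)"
begin

lemma volume_mem: "m \<le> n \<Longrightarrow> x \<in> U \<Longrightarrow> volume J m x \<in> U"
  by (induction m) (auto intro: mem)

lemma volume_linear: "m \<le> n \<Longrightarrow> linear_map_on U (volume J m)"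
proof (induction m)
  case (Suc m)
  then have "linear_map_on U (J m)" "linear_map_on U (volume J m)" "m \<le> n" using lin by auto
  then show ?case using volume_mem[of m] by (auto simp: linear_map_on_def)
qed (simp add: linear_map_on_def)

text \<open>\<open>J j\<close> changes sign when it passes a factor other than itself:
  \<open>m\<close> times if \<open>j\<close> is not among the factors, and once less if it
  is.\<close>

lemma volume_commute:
  assumes "m \<le> n" "j < n" "x \<in> U"
  shows "J j (volume J m x) = (if j < m then - ((-1) ^ m) else (-1) ^ m) *\<^sub>R volume J m (J j x)"
  using assms(1)
proof (induction m)
  case (Suc m)
  then have m: "m \<le> n" "m < n" by auto
  note IH = Suc.IH[OF m(1)]
  note v = volume_mem[OF m(1) assms(3)] volume_mem[OF m(1) mem[OF assms(2,3)]]
  note l = linear_map_onD(2)[OF lin[OF m(2)] v(2)]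
  show ?case
  proof (cases "j = m")
    case True
    then show ?thesis using IH l m v by simp
  next
    case False
    have "J j (J m (volume J m x)) = - J m (J j (volume J m x))"
      using anti[OF assms(2) m(2) False v(1)] .
    then show ?thesis using IH l False by auto
  qed
qed simp

text \<open>Moving \<open>m\<close> skew operators across the form costs \<open>m\<close> signs, and
  restoring their order costs \<open>m * (m - 1) / 2\<close> more; the total is the triangular
  number in the exponent.\<close>

lemma volume_adjoint:
  assumes "m \<le> n" "x \<in> U" "y \<in> U"
  shows "B (volume J m x) y = (-1) ^ (\<Sum>i\<le>m. i) * B x (volume J m y)"
  using assms
proof (induction m arbitrary: x y)
  case (Suc m)
  then have m: "m \<le> n" "m < n" by auto
  note v = volume_mem[OF m(1)] mem[OF m(2)]
  have "B (volume J (Suc m) x) y = - B (volume J m x) (J m y)"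
    using skew[OF m(2)] v Suc.prems by simp
  also have "\<dots> = - ((-1) ^ (\<Sum>i\<le>m. i) * B x (volume J m (J m y)))"
    using Suc.IH[OF m(1)] v Suc.prems by simp
  also have "volume J m (J m y) = (-1) ^ m *\<^sub>R volume J (Suc m) y"
    using volume_commute[OF m Suc.prems(3)] by simp
  also have "B x \<dots> = (-1) ^ m * B x (volume J (Suc m) y)"
    using bilinear_onD(2)[OF B _ Suc.prems(2), of "volume J (Suc m) y"] Suc.prems
      volume_mem[of "Suc m" y] by simp
  finally show ?case by (simp add: power_add)
qed simp

lemma J_eq_0: "i < n \<Longrightarrow> \<sigma> i \<noteq> 0 \<Longrightarrow> x \<in> U \<Longrightarrow> J i x = 0 \<Longrightarrow> x = 0"
  using sq[of i x] linear_map_onD(3)[OF lin subspace_0[OF U]] subspace_0[OF U] by auto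

lemma volume_eq_0:
  assumes "m \<le> n" "\<And>i. i < n \<Longrightarrow> \<sigma> i \<noteq> 0" "x \<in> U" "volume J m x = 0"
  shows "x = 0"
  using assms(1,4)
proof (induction m)
  case (Suc m)
  then show ?case using J_eq_0[of m "volume J m x"] assms volume_mem[of m x] by simp
qed simp

text \<open>Three factors arise: -1 from skewness, \<open>- \<sigma> j\<close> from commuting
  \<open>J j\<close> with an odd product, and \<open>\<sigma> j\<close> from its square. Their
  product is 1.\<close>

lemma volume_form_isometry:
  assumes r: "odd r" "r \<le> n" and \<sigma>: "\<And>i. i < n \<Longrightarrow> \<sigma> i = (if i < r then -1 else 1)"
    and j: "j < n" and x: "x \<in> U" "y \<in> U"
  shows "B (volume J r (J j x)) (J j y) = B (volume J r x) y"
proof -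
  note v = mem[OF j] volume_mem[OF r(2)]
  have "B (volume J r (J j x)) (J j y) = - B (J j (volume J r (J j x))) y"
    using skew[OF j] v x by simp
  also have "J j (volume J r (J j x)) = (- \<sigma> j) *\<^sub>R volume J r (J j (J j x))"
    using volume_commute[OF r(2) j v(1)[OF x(1)]] r \<sigma>[OF j] by auto
  also have "volume J r (J j (J j x)) = \<sigma> j *\<^sub>R volume J r x"
    using sq[OF j x(1)] linear_map_onD(2)[OF volume_linear[OF r(2)] x(1)] by simp
  finally show ?thesis
    using \<sigma>[OF j] bilinear_onD(1)[OF B v(2)[OF x(1)] x(2), of "-1"] by (simp split: if_splits)
qed

text \<open>Averaging over the finite group generated by the \<open>J i\<close>, one generator at a time.\<close>

lemma exists_invariant_inner_product:
  assumes fin: "finite S" "independent S" "U = span S"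
    and \<sigma>: "\<And>i. i < n \<Longrightarrow> \<sigma> i = 1 \<or> \<sigma> i = -1"
  shows "\<exists>K :: 'u \<Rightarrow> 'u \<Rightarrow> real. bilinear_on U K \<and> (\<forall>x y. K x y = K y x) \<and>
    (\<forall>x\<in>U. x \<noteq> 0 \<longrightarrow> K x x > 0) \<and> (\<forall>i<n. \<forall>x\<in>U. \<forall>y\<in>U. K (J i x) (J i y) = K x y)"
proof -
  have "\<exists>K :: 'u \<Rightarrow> 'u \<Rightarrow> real. bilinear_on U K \<and> (\<forall>x y. K x y = K y x) \<and>
    (\<forall>x\<in>U. x \<noteq> 0 \<longrightarrow> K x x > 0) \<and> (\<forall>i<m. \<forall>x\<in>U. \<forall>y\<in>U. K (J i x) (J i y) = K x y)" if "m \<le> n" for m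
    using that
  proof (induction m)
    case 0
    then show ?case using exists_inner_product_on_span[OF fin] by (metis not_less_zero)
  next
    case (Suc m)
    then obtain K :: "'u \<Rightarrow> 'u \<Rightarrow> real" where K: "bilinear_on U K" "\<And>x y. K x y = K y x"
      "\<And>x. x \<in> U \<Longrightarrow> x \<noteq> 0 \<Longrightarrow> K x x > 0"
      "\<And>i x y. i < m \<Longrightarrow> x \<in> U \<Longrightarrow> y \<in> U \<Longrightarrow> K (J i x) (J i y) = K x y"
      by (metis Suc_leD)
    have m: "m < n" using Suc by simp
    note sc = bilinear_onD(1,2)[OF K(1)]
    have neg: "K (- x) (- y) = K x y" if "x \<in> U" "y \<in> U" for x y
      using sc(1)[of x "- y" "-1"] sc(2)[of y x "-1"] that U by (simp add: subspace_neg)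
    \<comment> \<open>For \<open>i < m\<close> the signs from anticommutation cancel in pairs; for
      \<open>i = m\<close> the two summands are exchanged, since \<open>J m\<close> squares to plus
      or minus the identity.\<close>
    define K' where "K' x y = K x y + K (J m x) (J m y)" for x y
    have "bilinear_on U K'"
      using K(1) lin[OF m] mem[OF m] by (auto simp: K'_def bilinear_on_def linear_map_on_def algebra_simps)
    moreover have "K' x y = K' y x" for x y using K(2) by (simp add: K'_def)
    moreover have "K' x x > 0" if "x \<in> U" "x \<noteq> 0" for x
    proof -
      have "J m x \<noteq> 0" using J_eq_0[OF m _ that(1)] \<sigma>[OF m] that by auto
      then show ?thesis using K(3)[OF that] K(3)[OF mem[OF m that(1)]] by (simp add: K'_def)
    qed
    moreover have "K' (J i x) (J i y) = K' x y" if i: "i < Suc m" and x: "x \<in> U" and y: "y \<in> U" for i x y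
    proof (cases "i = m")
      case True
      have "K (J m (J m x)) (J m (J m y)) = K x y"
        using sq[OF m x] sq[OF m y] \<sigma>[OF m] neg[OF x y] by auto
      then show ?thesis by (simp add: K'_def True)
    next
      case False
      then have i: "i < m" "i < n" using i m by auto
      have "K (J m (J i x)) (J m (J i y)) = K (- J i (J m x)) (- J i (J m y))"
        using anti[OF m i(2)] False x y by simp
      also have "\<dots> = K (J m x) (J m y)"
        using neg K(4)[OF i(1)] mem[OF m] mem[OF i(2)] x y by simp
      finally show ?thesis using K(4)[OF i(1) x y] by (simp add: K'_def)
    qed
    ultimately show ?case by blast
  qed
  then show ?thesis by blast
qed

end

subsection \<open>Admissible modules\<close>

abbreviation unit_vec :: "nat \<Rightarrow> nat \<Rightarrow> real" where
  "unit_vec i \<equiv> (\<lambda>j. if j = i then 1 else 0)"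

lemma unit_vec_in_pseudo_space: "i < r + s \<Longrightarrow> unit_vec i \<in> pseudo_space r s"
  by (auto simp: pseudo_space_def)

lemma linear_map_on_subset: "linear_map_on U f \<Longrightarrow> W \<subseteq> U \<Longrightarrow> linear_map_on W f"
  unfolding linear_map_on_def subset_iff by metis

lemma bilinear_on_subset: "bilinear_on U B \<Longrightarrow> W \<subseteq> U \<Longrightarrow> bilinear_on W B"
  unfolding bilinear_on_def using linear_map_on_subset by (metis subsetD)

lemma pseudo_form_commute: "pseudo_form r s x y = pseudo_form r s y x"
  by (simp add: pseudo_form_def mult.commute)

lemma bilinear_on_pseudo_form: "bilinear_on V (pseudo_form r s)"
  unfolding bilinear_on_def linear_map_on_def
  by (auto simp: pseudo_form_add pseudo_form_scale)
    (simp_all add: pseudo_form_def scaleR_fun_def sum.distrib sum_distrib_left algebra_simps)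

lemma pseudo_form_unit_vec:
  "i < r + s \<Longrightarrow> j < r + s \<Longrightarrow>
    pseudo_form r s (unit_vec i) (unit_vec j) = (if i = j then if i < r then 1 else -1 else 0)"
  by (simp add: pseudo_form_basis)

lemma pseudo_space_expand:
  assumes "z \<in> pseudo_space r s"
  shows "z = (\<Sum>i<r + s. z i *\<^sub>R unit_vec i)"
proof
  fix j
  have "(\<Sum>i<n. z i *\<^sub>R unit_vec i) j = (\<Sum>i<n. if i = j then z j else 0)" for n :: nat
    by (induction n) (auto simp: scaleR_fun_def)
  then show "z j = (\<Sum>i<r + s. z i *\<^sub>R unit_vec i) j" using assms by (auto simp: pseudo_space_def)
qed

lemma linear_map_on_pseudo_space_expand:
  assumes "linear_map_on (pseudo_space r s) f" "z \<in> pseudo_space r s"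
  shows "f z = (\<Sum>i<r + s. z i *\<^sub>R f (unit_vec i))"
proof -
  have "f (\<Sum>i<r + s. z i *\<^sub>R unit_vec i) = (\<Sum>i<r + s. z i *\<^sub>R f (unit_vec i))"
    by (rule linear_map_on_sum[OF subspace_pseudo_space assms(1)]) (auto intro: unit_vec_in_pseudo_space)
  then show ?thesis using pseudo_space_expand[OF assms(2)] by simp
qed

lemma admissibleD:
  assumes "admissible r s M"
  shows "subspace (mod_space M)" "\<exists>S. finite S \<and> mod_space M = span S"
    "bilinear_on (mod_space M) (mod_form M)"
    "z \<in> pseudo_space r s \<Longrightarrow> x \<in> mod_space M \<Longrightarrow> cl_act M z x \<in> mod_space M"
    "z \<in> pseudo_space r s \<Longrightarrow> linear_map_on (mod_space M) (cl_act M z)"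
    "x \<in> mod_space M \<Longrightarrow> linear_map_on (pseudo_space r s) (\<lambda>z. cl_act M z x)"
    "z \<in> pseudo_space r s \<Longrightarrow> x \<in> mod_space M \<Longrightarrow>
      cl_act M z (cl_act M z x) = - pseudo_form r s z z *\<^sub>R x"
    "x \<in> mod_space M \<Longrightarrow> y \<in> mod_space M \<Longrightarrow> mod_form M x y = mod_form M y x"
    "x \<in> mod_space M \<Longrightarrow> (\<And>y. y \<in> mod_space M \<Longrightarrow> mod_form M x y = 0) \<Longrightarrow> x = 0"
    "z \<in> pseudo_space r s \<Longrightarrow> x \<in> mod_space M \<Longrightarrow> y \<in> mod_space M \<Longrightarrow>
      mod_form M (cl_act M z x) y = - mod_form M x (cl_act M z y)"
proof -
  let ?U = "mod_space M" and ?Z = "pseudo_space r s"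
  have a: "clifford_module r s ?U (cl_act M)" "bilinear_on ?U (mod_form M)"
    "\<forall>x\<in>?U. \<forall>y\<in>?U. mod_form M x y = mod_form M y x"
    "\<forall>x\<in>?U. (\<forall>y\<in>?U. mod_form M x y = 0) \<longrightarrow> x = 0"
    "\<forall>z\<in>?Z. \<forall>x\<in>?U. \<forall>y\<in>?U. mod_form M (cl_act M z x) y + mod_form M x (cl_act M z y) = 0"
    using assms unfolding admissible_def Let_def by - (elim conjE, assumption)+
  have c: "subspace ?U" "\<exists>S. finite S \<and> ?U = span S"
    "\<forall>z\<in>?Z. cl_act M z ` ?U \<subseteq> ?U \<and> linear_map_on ?U (cl_act M z)"
    "\<forall>x\<in>?U. linear_map_on ?Z (\<lambda>z. cl_act M z x)"
    "\<forall>z\<in>?Z. \<forall>x\<in>?U. cl_act M z (cl_act M z x) = - pseudo_form r s z z *\<^sub>R x"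
    using a(1) unfolding clifford_module_def by - (elim conjE, assumption)+
  show "subspace ?U" "\<exists>S. finite S \<and> ?U = span S" "bilinear_on ?U (mod_form M)"
    by (fact c a)+
  show "z \<in> ?Z \<Longrightarrow> x \<in> ?U \<Longrightarrow> cl_act M z x \<in> ?U" "z \<in> ?Z \<Longrightarrow> linear_map_on ?U (cl_act M z)"
    using c(3) by auto
  show "x \<in> ?U \<Longrightarrow> linear_map_on ?Z (\<lambda>z. cl_act M z x)" using c(4) by (rule bspec)
  show "z \<in> ?Z \<Longrightarrow> x \<in> ?U \<Longrightarrow> cl_act M z (cl_act M z x) = - pseudo_form r s z z *\<^sub>R x"
    using c(5) by metis
  show "x \<in> ?U \<Longrightarrow> y \<in> ?U \<Longrightarrow> mod_form M x y = mod_form M y x" using a(3) by metis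
  show "x \<in> ?U \<Longrightarrow> (\<And>y. y \<in> ?U \<Longrightarrow> mod_form M x y = 0) \<Longrightarrow> x = 0" using a(4) by metis
  show "z \<in> ?Z \<Longrightarrow> x \<in> ?U \<Longrightarrow> y \<in> ?U \<Longrightarrow> mod_form M (cl_act M z x) y = - mod_form M x (cl_act M z y)"
    using a(5) by (simp add: eq_neg_iff_add_eq_0)
qed

text \<open>Polarisation: expand the square of the action of \<open>z + w\<close> and subtract the
  squares of the two actions.\<close>

lemma admissible_anticommute:
  assumes M: "admissible r s M" and z: "z \<in> pseudo_space r s" and w: "w \<in> pseudo_space r s"
    and x: "x \<in> mod_space M" and orth: "pseudo_form r s z w = 0"
  shows "cl_act M z (cl_act M w x) = - cl_act M w (cl_act M z x)"
proof -
  note D = admissibleD[OF M]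
  have zw: "z + w \<in> pseudo_space r s" using z w subspace_pseudo_space by (blast intro: subspace_add)
  have add: "cl_act M (z + w) y = cl_act M z y + cl_act M w y" if "y \<in> mod_space M" for y
    using linear_map_onD(1)[OF D(6)[OF that] z w] .
  have m: "cl_act M z x \<in> mod_space M" "cl_act M w x \<in> mod_space M" using D(4) z w x by auto
  have "cl_act M (z + w) (cl_act M (z + w) x) =
      cl_act M z (cl_act M z x) + cl_act M z (cl_act M w x) + (cl_act M w (cl_act M z x) + cl_act M w (cl_act M w x))"
    using add[OF x] add[OF subspace_add[OF D(1) m]] linear_map_onD(1)[OF D(5)[OF z] m]
      linear_map_onD(1)[OF D(5)[OF w] m] by simp
  moreover have "pseudo_form r s (z + w) (z + w) = pseudo_form r s z z + pseudo_form r s w w"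
  proof -
    have "pseudo_form r s (z + w) z = pseudo_form r s z z" "pseudo_form r s (z + w) w = pseudo_form r s w w"
      using orth pseudo_form_commute[of r s w z]
        pseudo_form_commute[of r s "z + w" z] pseudo_form_commute[of r s "z + w" w]
      by (simp_all add: pseudo_form_add)
    then show ?thesis by (simp add: pseudo_form_add)
  qed
  ultimately have "cl_act M z (cl_act M w x) + cl_act M w (cl_act M z x) = 0"
    using D(7)[OF zw x] D(7)[OF z x] D(7)[OF w x] by (simp add: algebra_simps)
  then show ?thesis by (simp add: eq_neg_iff_add_eq_0)
qed

text \<open>Orthogonality suffices, without normalisation, so this covers both the unit vectors and
  their images under a map that only rescales the form.\<close>

lemma admissible_skew_system:
  assumes M: "admissible r s M" and w: "\<And>i. i < n \<Longrightarrow> w i \<in> pseudo_space r s"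
    and orth: "\<And>i j. i < n \<Longrightarrow> j < n \<Longrightarrow> i \<noteq> j \<Longrightarrow> pseudo_form r s (w i) (w j) = 0"
  shows "skew_system (mod_space M) (mod_form M) (\<lambda>i. cl_act M (w i)) n
    (\<lambda>i. - pseudo_form r s (w i) (w i))"
proof
  show "cl_act M (w i) (cl_act M (w j) x) = - cl_act M (w j) (cl_act M (w i) x)"
    if "i < n" "j < n" "i \<noteq> j" "x \<in> mod_space M" for i j x
    using admissible_anticommute[OF M w[OF that(1)] w[OF that(2)] that(4) orth[OF that(1-3)]] .
  note D = admissibleD[OF M]
  show "subspace (mod_space M)" "bilinear_on (mod_space M) (mod_form M)" by (rule D)+
  show "cl_act M (w i) x \<in> mod_space M" if "i < n" "x \<in> mod_space M" for i x
    by (rule D(4)[OF w[OF that(1)] that(2)])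
  show "linear_map_on (mod_space M) (cl_act M (w i))" if "i < n" for i by (rule D(5)[OF w[OF that]])
  show "cl_act M (w i) (cl_act M (w i) x) = - pseudo_form r s (w i) (w i) *\<^sub>R x"
    if "i < n" "x \<in> mod_space M" for i x
    by (rule D(7)[OF w[OF that(1)] that(2)])
  show "mod_form M (cl_act M (w i) x) y = - mod_form M x (cl_act M (w i) y)"
    if "i < n" "x \<in> mod_space M" "y \<in> mod_space M" for i x y
    by (rule D(10)[OF w[OF that(1)] that(2,3)])
qed


section \<open>Definiteness of the volume form on minimal modules\<close>

text \<open>For such \<open>r\<close> the sign in \<open>volume_adjoint\<close> is positive, which
  makes the volume form symmetric.\<close>

lemma triangular_even: "r mod 4 = 3 \<Longrightarrow> even (\<Sum>i\<le>r. i)" for r :: nat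
proof -
  assume "r mod 4 = 3"
  then obtain q where "r = 4 * q + 3" by (metis mult_div_mod_eq)
  then have "(\<Sum>i\<le>r. i) = 2 * ((4 * q + 3) * (q + 1))"
    using gauss_sum_nat[of r] by (simp add: atMost_atLeast0 algebra_simps)
  then show ?thesis by simp
qed

text \<open>An eigenspace of the volume form with respect to an invariant inner product is a
  non-degenerate submodule, hence everything.\<close>

lemma minimal_admissible_volume_form_definite:
  assumes min: "minimal_admissible r s M" and r: "r mod 4 = 3"
  shows "\<exists>l. \<forall>x\<in>mod_space M. x \<noteq> 0 \<longrightarrow>
    l * mod_form M (volume (\<lambda>i. cl_act M (unit_vec i)) r x) x > 0"
proof -
  define U where "U = mod_space M"
  define B where "B = mod_form M"
  define J where "J i = cl_act M (unit_vec i)" for i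
  define \<sigma> where "\<sigma> i = - pseudo_form r s (unit_vec i) (unit_vec i)" for i
  have M: "admissible r s M" and "U \<noteq> {0}" using min by (auto simp: minimal_admissible_def U_def)
  note D = admissibleD[OF M, folded U_def B_def]
  interpret skew_system U B J "r + s" \<sigma>
    unfolding U_def B_def J_def \<sigma>_def
    by (rule admissible_skew_system[OF M])
      (auto simp: unit_vec_in_pseudo_space pseudo_form_unit_vec)
  have \<sigma>: "\<sigma> i = (if i < r then -1 else 1)" if "i < r + s" for i
    using that by (simp add: \<sigma>_def pseudo_form_unit_vec)
  have odd: "odd r" using r by presburger
  obtain S0 where S0: "finite S0" "U = span S0" using D(2) by auto
  obtain S where S: "S \<subseteq> U" "independent S" "U \<subseteq> span S" using maximal_independent_subset by blast
  have fS: "finite S" using independent_span_bound[OF S0(1) S(2)] S(1) S0(2) by auto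
  have Us: "U = span S" using S U span_minimal by blast
  have "S \<noteq> {}" using Us \<open>U \<noteq> {0}\<close> by auto
  obtain K :: "'a \<Rightarrow> 'a \<Rightarrow> real" where K: "bilinear_on U K" "\<And>x y. K x y = K y x"
      "\<And>x. x \<in> U \<Longrightarrow> x \<noteq> 0 \<Longrightarrow> K x x > 0"
      "\<And>i x y. i < r + s \<Longrightarrow> x \<in> U \<Longrightarrow> y \<in> U \<Longrightarrow> K (J i x) (J i y) = K x y"
    using exists_invariant_inner_product[OF fS S(2) Us] \<sigma> by metis
  define H where "H x y = B (volume J r x) y" for x y
  have rn: "r \<le> r + s" by simp
  note vm = volume_mem[OF rn]
  have bH: "bilinear_on U H"
    using B vm volume_linear[OF rn] unfolding H_def by (simp add: bilinear_on_def linear_map_on_def)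
  have adj: "B (volume J r x) y = B x (volume J r y)" if "x \<in> U" "y \<in> U" for x y
    using volume_adjoint[OF rn that] triangular_even[OF r] by simp
  have symH: "H x y = H y x" if "x \<in> U" "y \<in> U" for x y
    using adj[OF that] D(8)[OF that(1) vm[OF that(2)]] by (simp add: H_def)
  have isoH: "H (J i x) (J i y) = H x y" if "i < r + s" "x \<in> U" "y \<in> U" for i x y
    using volume_form_isometry[OF odd rn \<sigma> that] by (simp add: H_def)
  obtain l x0 where x0: "x0 \<in> U" "x0 \<noteq> 0" "\<forall>y\<in>U. H x0 y = l * K x0 y"
    using symmetric_form_eigenvector[OF fS S(2) Us \<open>S \<noteq> {}\<close> bH symH K(1) K(2) K(3)] by blast
  \<comment> \<open>The volume operator is injective and \<open>B\<close> is non-degenerate, so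
    \<open>H\<close> has no radical and 0 is not an eigenvalue.\<close>
  have l: "l \<noteq> 0"
  proof
    assume "l = 0"
    then have "volume J r x0 = 0" using D(9)[OF vm[OF x0(1)]] x0 by (simp add: H_def)
    moreover have "\<sigma> i \<noteq> 0" if "i < r + s" for i using \<sigma>[OF that] by simp
    ultimately show False using volume_eq_0[OF rn _ x0(1)] x0(2) by blast
  qed
  \<comment> \<open>The eigenspace of \<open>H\<close> relative to \<open>K\<close> for the
    eigenvalue \<open>l\<close>.\<close>
  define W where "W = {x\<in>U. \<forall>y\<in>U. H x y = l * K x y}"
  have W: "subspace W"
  proof (rule subspaceI)
    show "0 \<in> W"
      using bilinear_onD(1)[OF bH x0(1), of _ 0] bilinear_onD(1)[OF K(1) x0(1), of _ 0] U
      by (simp add: W_def subspace_0)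
    show "x + y \<in> W" if "x \<in> W" "y \<in> W" for x y
      using that bilinear_onD(3)[OF bH] bilinear_onD(3)[OF K(1)] U
      by (simp add: W_def subspace_add distrib_left)
    show "c *\<^sub>R x \<in> W" if "x \<in> W" for c x
      using that bilinear_onD(1)[OF bH] bilinear_onD(1)[OF K(1)] U by (simp add: W_def subspace_scale)
  qed
  \<comment> \<open>Both \<open>H\<close> and \<open>K\<close> are invariant under
    \<open>J i\<close>. Pairing \<open>J i x\<close> with \<open>J i (J i y)\<close>, which is
    \<open>y\<close> up to sign, reduces the equation for \<open>J i x\<close> to that for
    \<open>x\<close>.\<close>
  have JW: "J i x \<in> W" if i: "i < r + s" and x: "x \<in> W" for i x
  proof -
    have xU: "x \<in> U" and e: "\<And>y. y \<in> U \<Longrightarrow> H x y = l * K x y" using x by (auto simp: W_def)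
    have "H (J i x) y = l * K (J i x) y" if y: "y \<in> U" for y
    proof -
      note yy = mem[OF i y] mem[OF i mem[OF i y]]
      have "H (J i x) (\<sigma> i *\<^sub>R y) = l * K (J i x) (\<sigma> i *\<^sub>R y)"
        using isoH[OF i xU yy(1)] K(4)[OF i xU yy(1)] e[OF yy(1)] sq[OF i y] by simp
      then show ?thesis
        using bilinear_onD(2)[OF bH y mem[OF i xU]] bilinear_onD(2)[OF K(1) y mem[OF i xU]] \<sigma>[OF i]
        by (auto split: if_splits)
    qed
    then show ?thesis using mem[OF i xU] by (simp add: W_def)
  qed
  have vW: "volume J m x \<in> W" if "m \<le> r + s" "x \<in> W" for m x
    using that by (induction m) (auto intro: JW)
  have WU: "W \<subseteq> U" by (auto simp: W_def)
  define M1 where "M1 = \<lparr>mod_space = W, cl_act = cl_act M, mod_form = mod_form M\<rparr>"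
  have "admissible r s M1"
    unfolding admissible_def Let_def M1_def clifford_module_def form_module.simps
  proof (intro conjI ballI impI)
    obtain C where "C \<subseteq> W" "independent C" "W \<subseteq> span C" using maximal_independent_subset by blast
    then have "finite C" "W = span C"
      using independent_span_bound[OF S0(1), of C] WU S0(2) W span_minimal[of C W] by auto
    then show "\<exists>S. finite S \<and> W = span S" by blast
    show "linear_map_on W (cl_act M z)" if "z \<in> pseudo_space r s" for z
      by (rule linear_map_on_subset[OF D(5)[OF that] WU])
    show "bilinear_on W (mod_form M)"
      using bilinear_on_subset[OF B WU] by (simp add: B_def)
    show "cl_act M z ` W \<subseteq> W" if z: "z \<in> pseudo_space r s" for z
    proof safe
      fix x assume x: "x \<in> W"
      then have "cl_act M z x = (\<Sum>i<r + s. z i *\<^sub>R J i x)"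
        using linear_map_on_pseudo_space_expand[OF D(6) z] WU by (auto simp: J_def)
      then show "cl_act M z x \<in> W" using JW x W by (auto intro!: subspace_sum subspace_scale)
    qed
    \<comment> \<open>A nonzero \<open>x\<close> pairs nontrivially with its own image under the
      volume operator, which stays in \<open>W\<close>: the value is
      \<open>H x x = l * K x x\<close>.\<close>
    show "x = 0" if x: "x \<in> W" and "\<forall>y\<in>W. mod_form M x y = 0" for x
    proof (rule ccontr)
      assume "x \<noteq> 0"
      have xU: "x \<in> U" using x WU by auto
      have "B x (volume J r x) = 0" using that vW[OF rn x] by (simp add: B_def)
      then have "H x x = 0" using adj[OF xU xU] by (simp add: H_def)
      then show False using x l K(3)[OF xU \<open>x \<noteq> 0\<close>] by (auto simp: W_def)
    qed
    show "mod_form M (cl_act M z x) y + mod_form M x (cl_act M z y) = 0"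
      if "z \<in> pseudo_space r s" "x \<in> W" "y \<in> W" for x y z
      using D(10)[OF that(1) subsetD[OF WU that(2)] subsetD[OF WU that(3)]] by (simp add: B_def)
    show "subspace W" by (rule W)
    show "linear_map_on (pseudo_space r s) (\<lambda>z. cl_act M z x)" if "x \<in> W" for x
      by (rule D(6)[OF subsetD[OF WU that]])
    show "cl_act M z (cl_act M z x) = - pseudo_form r s z z *\<^sub>R x" if "z \<in> pseudo_space r s" "x \<in> W" for z x
      by (rule D(7)[OF that(1) subsetD[OF WU that(2)]])
    show "mod_form M x y = mod_form M y x" if "x \<in> W" "y \<in> W" for x y
      using D(8)[OF subsetD[OF WU that(1)] subsetD[OF WU that(2)]] by (simp add: B_def)
  qed
  moreover have "x0 \<in> W" using x0 by (auto simp: W_def)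
  then have "mod_space M1 \<noteq> {0}" using x0(2) by (auto simp: M1_def)
  ultimately have "dim U \<le> dim W"
    using min by (auto simp: minimal_admissible_def U_def M1_def)
  then have "W = U" using subspace_eqI_dim[OF W WU S0] by simp
  then have "H x x = l * K x x" if "x \<in> U" for x using that by (auto simp: W_def)
  \<comment> \<open>The factor \<open>l\<close> in the claim absorbs the unknown sign of the
    eigenvalue.\<close>
  then have "l * H x x = l\<^sup>2 * K x x" if "x \<in> U" for x using that by (simp add: power2_eq_square)
  then have "l * H x x > 0" if "x \<in> U" "x \<noteq> 0" for x using K(3)[OF that] that l by simp
  then show ?thesis unfolding H_def U_def B_def J_def by blast
qed

subsection \<open>Isomorphisms of pseudo H-type algebras\<close>

lemma linear_map_on_inv_into:
  assumes U: "subspace U" and f: "linear_map_on U f" and b: "bij_betw f U V"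
  shows "linear_map_on V (inv_into U f)"
proof -
  note g = bij_betw_inv_into_left[OF b] bij_betw_inv_into_right[OF b]
    bij_betwE[OF bij_betw_inv_into[OF b], rule_format]
  show ?thesis
    unfolding linear_map_on_def
  proof (intro conjI ballI allI)
    fix x y assume x: "x \<in> V" and y: "y \<in> V"
    have "f (inv_into U f x + inv_into U f y) = x + y"
      using linear_map_onD(1)[OF f g(3)[OF x] g(3)[OF y]] g(2) x y by simp
    then show "inv_into U f (x + y) = inv_into U f x + inv_into U f y"
      using g(1)[OF subspace_add[OF U g(3)[OF x] g(3)[OF y]]] by simp
  next
    fix c x assume x: "x \<in> V"
    have "f (c *\<^sub>R inv_into U f x) = c *\<^sub>R x"
      using linear_map_onD(2)[OF f g(3)[OF x]] g(2) x by simp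
    then show "inv_into U f (c *\<^sub>R x) = c *\<^sub>R inv_into U f x"
      using g(1)[OF subspace_scale[OF U g(3)[OF x], of c]] by simp
  qed
qed

lemma centre_bracket_zero:
  assumes M: "admissible r s M" and x: "x \<in> mod_space M"
  shows "centre_bracket r s M 0 x = 0"
proof (rule centre_bracket_eqI[OF M _ x])
  note D = admissibleD[OF M]
  show 0: "0 \<in> mod_space M" "0 \<in> pseudo_space r s"
    using D(1) subspace_pseudo_space by (auto intro: subspace_0)
  fix z assume z: "z \<in> pseudo_space r s"
  have "mod_form M 0 x = 0" using bilinear_onD(1)[OF D(3) 0(1) x, of 0] by simp
  then show "mod_form M (cl_act M z 0) x = pseudo_form r s z 0"
    using linear_map_onD(3)[OF D(5)[OF z] 0(1)] by (simp add: pseudo_form_def)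
qed

lemma cl_act_eq_0:
  assumes "admissible r s M" "z \<in> pseudo_space r s" "x \<in> mod_space M" "cl_act M z x = 0"
    and "pseudo_form r s z z \<noteq> 0"
  shows "x = 0"
  using admissibleD(7)[OF assms(1-3)] assms(4,5)
    linear_map_onD(3)[OF admissibleD(5)[OF assms(1,2)] assms(3)] by simp

text \<open>A positive direction acts injectively and the form is non-degenerate. Hence no nonzero
  vector of the module is central, and isomorphisms preserve the centres.\<close>

lemma centre_bracket_nondegenerate:
  assumes M: "admissible r s M" and n: "0 < r" and x: "x \<in> mod_space M"
    and 0: "\<And>y. y \<in> mod_space M \<Longrightarrow> centre_bracket r s M x y = 0"
  shows "x = 0"
proof -
  have e: "unit_vec 0 \<in> pseudo_space r s" using n by (intro unit_vec_in_pseudo_space) simp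
  note D = admissibleD[OF M]
  have "mod_form M (cl_act M (unit_vec 0) x) y = 0" if "y \<in> mod_space M" for y
    using centre_bracket(2)[OF M x that e] 0[OF that] by (simp add: pseudo_form_def)
  then have "cl_act M (unit_vec 0) x = 0" using D(9)[OF D(4)[OF e x]] by simp
  then show ?thesis using cl_act_eq_0[OF M e x] n by (simp add: pseudo_form_unit_vec)
qed

text \<open>\<open>G\<close> is the inverse transpose of the map that the isomorphism induces between the centres.\<close>

lemma lie_isomorphic_intertwines:
  assumes M: "admissible r s M" and M': "admissible s r M'" and r: "0 < r" and s: "0 < s"
    and iso: "lie_isomorphic (pseudo_H_type r s M) (pseudo_H_type s r M')"
  obtains A G where "linear_map_on (mod_space M) A" "A ` mod_space M = mod_space M'"
    "\<And>x. x \<in> mod_space M \<Longrightarrow> A x = 0 \<Longrightarrow> x = 0"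
    "linear_map_on (pseudo_space r s) G"
    "\<And>z. z \<in> pseudo_space r s \<Longrightarrow> G z \<in> pseudo_space s r"
    "\<And>z x y. z \<in> pseudo_space r s \<Longrightarrow> x \<in> mod_space M \<Longrightarrow> y \<in> mod_space M \<Longrightarrow>
      mod_form M' (cl_act M' (G z) (A x)) (A y) = mod_form M (cl_act M z x) y"
proof -
  define U where "U = mod_space M"
  define U' where "U' = mod_space M'"
  define Z where "Z = pseudo_space r s"
  define Z' where "Z' = pseudo_space s r"
  define b where "b = centre_bracket r s M"
  define b' where "b' = centre_bracket s r M'"
  note defs = U_def U'_def Z_def Z'_def b_def b'_def
  have U: "subspace U" and U': "subspace U'" and Z: "subspace Z" and Z': "subspace Z'"
    using admissibleD(1)[OF M] admissibleD(1)[OF M'] by (simp_all add: defs subspace_pseudo_space)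
  note z0 = subspace_0[OF U] subspace_0[OF U'] subspace_0[OF Z] subspace_0[OF Z']
  have bZ: "b x y \<in> Z" if "x \<in> U" "y \<in> U" for x y
    using centre_bracket(1)[OF M] that by (simp add: defs)
  have b0: "b 0 y = 0" if "y \<in> U" for y using centre_bracket_zero[OF M] that by (simp add: defs)
  have b'0: "b' 0 y = 0" if "y \<in> U'" for y using centre_bracket_zero[OF M'] that by (simp add: defs)
  obtain \<phi> where lin: "linear_map_on (U \<times> Z) \<phi>" and bij: "bij_betw \<phi> (U \<times> Z) (U' \<times> Z')"
    and br: "\<And>p q. p \<in> U \<times> Z \<Longrightarrow> q \<in> U \<times> Z \<Longrightarrow>
      \<phi> (0, b (fst p) (fst q)) = (0, b' (fst (\<phi> p)) (fst (\<phi> q)))"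
    using iso unfolding lie_isomorphic_def pseudo_H_type_def lie_alg.simps defs by blast
  have \<phi>mem: "fst (\<phi> p) \<in> U'" "snd (\<phi> p) \<in> Z'" if "p \<in> U \<times> Z" for p
    using bij_betwE[OF bij, rule_format, OF that] by (auto simp: mem_Times_iff)
  have surj: "\<exists>p\<in>U \<times> Z. \<phi> p = q" if "q \<in> U' \<times> Z'" for q
    using bij that unfolding bij_betw_def by (metis imageE)
  have inj: "p = q" if "\<phi> p = \<phi> q" "p \<in> U \<times> Z" "q \<in> U \<times> Z" for p q
    using bij that unfolding bij_betw_def by (meson inj_onD)
  \<comment> \<open>The diagonal blocks of \<open>\<phi>\<close>. Its remaining component, from the
    module into the centre, does not affect brackets.\<close>
  define A where "A x = fst (\<phi> (x, 0))" for x
  define C where "C a = snd (\<phi> (0, a))" for a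
  have \<phi>0: "\<phi> (0, 0) = (0, 0)"
    using linear_map_onD(3)[OF lin, of "(0, 0)"] z0 by (simp add: zero_prod_def)
  \<comment> \<open>\<open>(0, a)\<close> is central and \<open>\<phi>\<close> is onto, so the
    module part of its image has zero bracket with everything.\<close>
  have centre: "fst (\<phi> (0, a)) = 0" if a: "a \<in> Z" for a
  proof -
    have m: "(0, a) \<in> U \<times> Z" using a z0 by simp
    have "b' (fst (\<phi> (0, a))) y = 0" if y: "y \<in> U'" for y
    proof -
      obtain p where p: "p \<in> U \<times> Z" "\<phi> p = (y, 0)" using surj[of "(y, 0)"] y z0 by auto
      have "b 0 (fst p) = 0" using b0 p(1) by (simp add: mem_Times_iff)
      then show ?thesis using br[OF m p(1)] p(2) \<phi>0 by simp
    qed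
    then show ?thesis
      using centre_bracket_nondegenerate[OF M' s] \<phi>mem(1)[OF m] by (simp add: defs)
  qed
  have split: "\<phi> (x, a) = \<phi> (x, 0) + \<phi> (0, a)" if "x \<in> U" "a \<in> Z" for x a
    using linear_map_onD(1)[OF lin, of "(x, 0)" "(0, a)"] that z0 by simp
  have fstA: "fst (\<phi> (x, a)) = A x" if "x \<in> U" "a \<in> Z" for x a
    using split[OF that] centre[OF that(2)] by (simp add: A_def)
  have \<phi>C: "\<phi> (0, a) = (0, C a)" if "a \<in> Z" for a
    using centre[OF that] by (simp add: C_def prod_eq_iff)
  have A_lin: "linear_map_on U A"
    unfolding linear_map_on_def
  proof (intro conjI ballI allI)
    show "A (x + y) = A x + A y" if "x \<in> U" "y \<in> U" for x y
      using linear_map_onD(1)[OF lin, of "(x, 0)" "(y, 0)"] that z0 by (simp add: A_def)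
    show "A (c *\<^sub>R x) = c *\<^sub>R A x" if "x \<in> U" for c x
      using linear_map_onD(2)[OF lin, of "(x, 0)" c] that z0 by (simp add: A_def)
  qed
  have C_lin: "linear_map_on Z C"
    unfolding linear_map_on_def
  proof (intro conjI ballI allI)
    show "C (x + y) = C x + C y" if "x \<in> Z" "y \<in> Z" for x y
      using linear_map_onD(1)[OF lin, of "(0, x)" "(0, y)"] that z0 by (simp add: C_def)
    show "C (c *\<^sub>R x) = c *\<^sub>R C x" if "x \<in> Z" for c x
      using linear_map_onD(2)[OF lin, of "(0, x)" c] that z0 by (simp add: C_def)
  qed
  have Amem: "A x \<in> U'" if "x \<in> U" for x using \<phi>mem(1)[of "(x, 0)"] that z0 by (simp add: A_def)
  have brA: "C (b x y) = b' (A x) (A y)" if "x \<in> U" "y \<in> U" for x y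
    using br[of "(x, 0)" "(y, 0)"] \<phi>C[OF bZ[OF that]] that z0 by (simp add: A_def)
  have A_inj: "x = 0" if x: "x \<in> U" and "A x = 0" for x
  proof -
    have "b x y = 0" if y: "y \<in> U" for y
    proof -
      have "\<phi> (0, b x y) = \<phi> (0, 0)"
        using \<phi>C[OF bZ[OF x y]] brA[OF x y] b'0[OF Amem[OF y]] \<phi>0 \<open>A x = 0\<close> by simp
      then show ?thesis using inj[of "(0, b x y)" "(0, 0)"] bZ[OF x y] z0 by simp
    qed
    then show ?thesis using centre_bracket_nondegenerate[OF M r] x by (simp add: defs)
  qed
  have A_surj: "A ` U = U'"
  proof
    show "A ` U \<subseteq> U'" using Amem by blast
    show "U' \<subseteq> A ` U"
    proof
      fix u assume "u \<in> U'"
      then obtain x a where "x \<in> U" "a \<in> Z" "\<phi> (x, a) = (u, 0)" using surj[of "(u, 0)"] z0 by auto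
      then show "u \<in> A ` U" using fstA[of x a] by auto
    qed
  qed
  have C_bij: "bij_betw C Z Z'"
    unfolding bij_betw_def
  proof (intro conjI subset_antisym subsetI inj_onI)
    show "x = y" if "x \<in> Z" "y \<in> Z" "C x = C y" for x y
      using inj[of "(0, x)" "(0, y)"] \<phi>C that z0 by simp
    show "c \<in> Z'" if "c \<in> C ` Z" for c using that \<phi>mem(2)[of "(0, _)"] z0 by (auto simp: C_def)
    show "c \<in> C ` Z" if c: "c \<in> Z'" for c
    proof -
      obtain x a where p: "x \<in> U" "a \<in> Z" "\<phi> (x, a) = (0, c)" using surj[of "(0, c)"] c z0 by auto
      then have "x = 0" using fstA[of x a] A_inj by simp
      then show ?thesis using p \<phi>C[of a] by auto
    qed
  qed
  define Ci where "Ci = inv_into Z C"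
  have Ci_lin: "linear_map_on Z' Ci" unfolding Ci_def by (rule linear_map_on_inv_into[OF Z C_lin C_bij])
  have Ci: "Ci (C a) = a" if "a \<in> Z" for a unfolding Ci_def by (rule bij_betw_inv_into_left[OF C_bij that])
  have f_lin: "linear_map_on Z' (\<lambda>c. pseudo_form r s z (Ci c))" for z
    using Ci_lin by (simp add: linear_map_on_def pseudo_form_add pseudo_form_scale)
  note rep = pseudo_form_represents[OF f_lin[unfolded Z'_def], folded Z'_def]
  \<comment> \<open>The adjoint of \<open>Ci\<close>, the inverse of \<open>C\<close>, with respect
    to the two pseudo-Euclidean forms.\<close>
  define G where "G z = (THE w. w \<in> Z' \<and> (\<forall>c\<in>Z'. pseudo_form r s z (Ci c) = pseudo_form s r c w))" for z
  have G': "G z \<in> Z' \<and> (\<forall>c\<in>Z'. pseudo_form r s z (Ci c) = pseudo_form s r c (G z))" for z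
    unfolding G_def by (rule theI'[OF rep])
  have G: "G z \<in> Z'" for z using G'[of z] by (rule conjunct1)
  have Gc: "pseudo_form r s z (Ci c) = pseudo_form s r c (G z)" if "c \<in> Z'" for z c
    by (rule bspec[OF conjunct2[OF G'] that])
  have G_eqI: "G z = w" if "w \<in> Z'" "\<And>c. c \<in> Z' \<Longrightarrow> pseudo_form r s z (Ci c) = pseudo_form s r c w" for z w
    unfolding G_def by (rule the1_equality[OF rep]) (intro conjI ballI that)
  note left = bilinear_onD(1,3)[OF bilinear_on_pseudo_form[of UNIV], simplified]
  have G_lin: "linear_map_on Z G"
    unfolding linear_map_on_def
  proof (intro conjI ballI allI)
    show "G (x + y) = G x + G y" for x y
      by (rule G_eqI[OF subspace_add[OF Z' G G]]) (simp only: left UNIV_I pseudo_form_add Gc)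
    show "G (c *\<^sub>R x) = c *\<^sub>R G x" for c x
      by (rule G_eqI[OF subspace_scale[OF Z' G]])
        (simp only: left UNIV_I pseudo_form_scale real_scaleR_def Gc)
  qed
  have main: "mod_form M' (cl_act M' (G z) (A x)) (A y) = mod_form M (cl_act M z x) y"
    if "z \<in> Z" "x \<in> U" "y \<in> U" for x y z
  proof -
    have "mod_form M' (cl_act M' (G z) (A x)) (A y) = pseudo_form s r (G z) (b' (A x) (A y))"
      using centre_bracket(2)[OF M'] Amem G that by (simp add: defs)
    also have "\<dots> = pseudo_form s r (C (b x y)) (G z)" using brA[OF that(2,3)] by (simp add: pseudo_form_commute[of s r "G z"])
    also have "\<dots> = pseudo_form r s z (b x y)"
      using Gc[of "C (b x y)" z] Ci[OF bZ[OF that(2,3)]] bij_betwE[OF C_bij, rule_format, OF bZ[OF that(2,3)]]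
      by simp
    also have "\<dots> = mod_form M (cl_act M z x) y"
      using centre_bracket(2)[OF M] that by (simp add: defs)
    finally show ?thesis .
  qed
  show ?thesis
    using that[of A G] A_lin A_surj A_inj G_lin G main by (simp add: defs)
qed

subsection \<open>Forms vanishing on the null cone\<close>

lemma linear_eq_on_pseudo_space:
  assumes "linear_map_on (pseudo_space r s) f" "linear_map_on (pseudo_space r s) g"
    and "\<And>i. i < r + s \<Longrightarrow> f (unit_vec i) = g (unit_vec i)" "z \<in> pseudo_space r s"
  shows "f z = g z"
  using assms by (simp add: linear_map_on_pseudo_space_expand)

text \<open>It suffices to compare on unit vectors. Null sums and differences of a positive and a
  negative one fix the diagonal up to \<open>c\<close> and kill the mixed entries; the entries of
  equal sign need null combinations of three unit vectors.\<close>

lemma vanishing_on_null_cone: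
  fixes q :: "(nat \<Rightarrow> real) \<Rightarrow> (nat \<Rightarrow> real) \<Rightarrow> real"
  assumes q: "bilinear_on (pseudo_space r s) q"
    and sym: "\<And>z w. z \<in> pseudo_space r s \<Longrightarrow> w \<in> pseudo_space r s \<Longrightarrow> q z w = q w z"
    and null: "\<And>z. z \<in> pseudo_space r s \<Longrightarrow> pseudo_form r s z z = 0 \<Longrightarrow> q z z = 0"
    and pos: "0 < r" "0 < s"
  shows "\<exists>c. \<forall>z\<in>pseudo_space r s. \<forall>w\<in>pseudo_space r s. q z w = c * pseudo_form r s z w"
proof -
  let ?Z = "pseudo_space r s" and ?p = "pseudo_form r s"
  note Z = subspace_add[OF subspace_pseudo_space] subspace_scale[OF subspace_pseudo_space]
  note e = unit_vec_in_pseudo_space[of _ r s]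
  have comb: "B (a *\<^sub>R x + b *\<^sub>R y + c *\<^sub>R z) (a *\<^sub>R x + b *\<^sub>R y + c *\<^sub>R z) =
      a\<^sup>2 * B x x + b\<^sup>2 * B y y + c\<^sup>2 * B z z + 2 * a * b * B x y + 2 * a * c * B x z + 2 * b * c * B y z"
    if B: "bilinear_on ?Z B" and s: "\<And>z w. z \<in> ?Z \<Longrightarrow> w \<in> ?Z \<Longrightarrow> B z w = B w z"
      and m: "x \<in> ?Z" "y \<in> ?Z" "z \<in> ?Z" for B :: "(nat \<Rightarrow> real) \<Rightarrow> (nat \<Rightarrow> real) \<Rightarrow> real" and a b c x y z
    using m by (simp add: bilinear_onD[OF B] Z s[of y x] s[of z x] s[of z y] power2_eq_square algebra_simps)
  \<comment> \<open>The hypothesis \<open>null\<close> for a combination of three vectors, as a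
    polynomial identity in the coefficients.\<close>
  have nullc: "a\<^sup>2 * q x x + b\<^sup>2 * q y y + c\<^sup>2 * q z z + 2 * a * b * q x y + 2 * a * c * q x z + 2 * b * c * q y z = 0"
    if "a\<^sup>2 * ?p x x + b\<^sup>2 * ?p y y + c\<^sup>2 * ?p z z + 2 * a * b * ?p x y + 2 * a * c * ?p x z + 2 * b * c * ?p y z = 0"
      and m: "x \<in> ?Z" "y \<in> ?Z" "z \<in> ?Z" for a b c x y z
    using null[of "a *\<^sub>R x + b *\<^sub>R y + c *\<^sub>R z"] comb[OF q sym m, of a b c]
      comb[OF bilinear_on_pseudo_form pseudo_form_commute m, of r s a b c] that m
    by (simp add: Z)
  define u where "u i = q (unit_vec i) (unit_vec i)" for i
  define v where "v i j = q (unit_vec i) (unit_vec j)" for i j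
  have vs: "v i j = v j i" if "i < r + s" "j < r + s" for i j
    using sym[OF e[OF that(1)] e[OF that(2)]] by (simp add: v_def)
  have P: "?p (unit_vec i) (unit_vec j) = (if i = j then if i < r then 1 else -1 else 0)"
    if "i < r + s" "j < r + s" for i j by (rule pseudo_form_unit_vec[OF that])
  have pm: "u i + u j + 2 * v i j = 0 \<and> u i + u j - 2 * v i j = 0"
    if i: "i < r" and j: "r \<le> j" "j < r + s" for i j
  proof -
    have i': "i < r + s" using i by simp
    \<comment> \<open>Only two vectors matter here: the third gets coefficient 0, and the second
      gets 1 and -1 in turn.\<close>
    note n = nullc[OF _ e[OF i'] e[OF j(2)] e[OF i'], of 1 _ 0]
    show ?thesis
      using n[of 1] n[of "-1"] P[OF i' i'] P[OF j(2) j(2)] P[OF i' j(2)] i j by (simp add: u_def v_def)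
  qed
  have mixed: "v i j = 0" "u j = - u i" if "i < r" "r \<le> j" "j < r + s" for i j
    using pm[OF that] by linarith+
  define c where "c = u 0"
  have neg: "u j = - c" if "r \<le> j" "j < r + s" for j using mixed(2)[of 0 j] pos that by (simp add: c_def)
  have posu: "u i = c" if "i < r" for i using mixed(2)[of i r] neg[of r] pos that by simp
  have same: "v i k = 0" if ik: "i \<noteq> k" "i < r + s" "k < r + s" and b: "(i < r) = (k < r)" for i k
  proof -
    \<comment> \<open>Some index whose sign is opposite to that of \<open>i\<close> and
      \<open>k\<close>.\<close>
    define j where "j = (if i < r then r else 0)"
    have j: "j < r + s" "i \<noteq> j" "k \<noteq> j" "(j < r) \<noteq> (i < r)" using b pos by (auto simp: j_def)
    have vj: "v i j = 0" "v k j = 0"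
      using mixed(1)[of i r] mixed(1)[of k r] mixed(1)[of 0 i] mixed(1)[of 0 k] vs ik b pos
      by (auto simp: j_def)
    have uj: "u j = - u i" "u k = u i"
      using posu[of i] posu[of k] posu[of j] neg[of i] neg[of k] neg[of j] b j ik by auto
    txt \<open>The Pythagorean triple makes \<open>3 e\<^sub>i + 4 e\<^sub>k + 5 e\<^sub>j\<close> a null vector.\<close>
    have "3\<^sup>2 * u i + 4\<^sup>2 * u k + 5\<^sup>2 * u j + 2 * 3 * 4 * v i k + 2 * 3 * 5 * v i j + 2 * 4 * 5 * v k j = 0"
      unfolding u_def v_def
      by (rule nullc[OF _ e[OF ik(2)] e[OF ik(3)] e[OF j(1)]])
        (use P[OF ik(2,2)] P[OF ik(3,3)] P[OF j(1,1)] P[OF ik(2,3)] P[OF ik(2) j(1)] P[OF ik(3) j(1)] ik b j in auto)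
    then show ?thesis using vj uj by simp
  qed
  have vP: "v i j = c * ?p (unit_vec i) (unit_vec j)" if ij: "i < r + s" "j < r + s" for i j
  proof (cases "i = j")
    case True
    then show ?thesis using P[OF ij] posu[of i] neg[of i] ij by (auto simp: u_def v_def)
  next
    case False
    then have "v i j = 0"
      using same[OF False ij] mixed(1)[of i j] mixed(1)[of j i] vs[OF ij] ij by (cases "i < r"; cases "j < r") auto
    then show ?thesis using P[OF ij] False by simp
  qed
  have lq: "linear_map_on ?Z (q z)" "linear_map_on ?Z (\<lambda>z. q z w)"
    and lp: "linear_map_on ?Z (\<lambda>w. c * ?p z w)" "linear_map_on ?Z (\<lambda>z. c * ?p z w)"
    if "z \<in> ?Z" "w \<in> ?Z" for z w
    using q that bilinear_onD(1,3)[OF bilinear_on_pseudo_form[of UNIV r s], simplified]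
    by (auto simp: bilinear_on_def linear_map_on_def pseudo_form_add pseudo_form_scale algebra_simps)
  have qe: "q (unit_vec i) w = c * ?p (unit_vec i) w" if "i < r + s" "w \<in> ?Z" for i w
    by (rule linear_eq_on_pseudo_space[OF lq(1) lp(1)]) (use e vP that in \<open>auto simp: v_def\<close>)
  have "q z w = c * ?p z w" if "z \<in> ?Z" "w \<in> ?Z" for z w
    by (rule linear_eq_on_pseudo_space[OF lq(2) lp(2)]) (use qe that in auto)
  then show ?thesis by blast
qed

section \<open>Inertia of the pseudo-Euclidean forms\<close>

text \<open>With \<open>z\<close> supported in \<open>J\<close>, the conditions on
  \<open>G z\<close> are \<open>card I\<close> homogeneous linear equations in \<open>card J\<close>
  unknowns.\<close>

lemma exists_vanishing_coordinates:
  assumes G: "linear_map_on (pseudo_space r s) G" and J: "J \<subseteq> {..<r + s}" "finite I" "card I < card J"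
  shows "\<exists>z\<in>pseudo_space r s. (\<exists>j\<in>J. z j \<noteq> 0) \<and> (\<forall>j. j \<notin> J \<longrightarrow> z j = 0) \<and> (\<forall>i\<in>I. (G z :: nat \<Rightarrow> real) i = 0)"
proof -
  have fJ: "finite J" using J(1) finite_subset by blast
  obtain y where y: "\<exists>j\<in>J. y j \<noteq> 0" "\<forall>i\<in>I. (\<Sum>j\<in>J. G (unit_vec j) i * y j) = 0"
    using homogeneous_system_nontrivial[OF J(2) fJ J(3), of "\<lambda>i j. G (unit_vec j) i"] by blast
  define z where "z j = (if j \<in> J then y j else 0)" for j
  have z: "z \<in> pseudo_space r s" using J(1) by (auto simp: z_def pseudo_space_def)
  have "(G z) i = (\<Sum>j\<in>J. G (unit_vec j) i * y j)" for i
  proof -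
    have app: "(\<Sum>j\<in>T. z j *\<^sub>R G (unit_vec j)) i = (\<Sum>j\<in>T. z j * G (unit_vec j) i)" if "finite T" for T
      using that by (induction T) (auto simp: scaleR_fun_def)
    have "(G z) i = (\<Sum>j<r + s. z j * G (unit_vec j) i)"
      unfolding linear_map_on_pseudo_space_expand[OF G z] by (rule app) simp
    also have "\<dots> = (\<Sum>j\<in>J. z j * G (unit_vec j) i)"
      using J(1) by (intro sum.mono_neutral_right) (auto simp: z_def)
    finally show ?thesis by (simp add: z_def mult.commute)
  qed
  then show ?thesis using y z by (intro bexI[OF _ z]) (auto simp: z_def)
qed

text \<open>Sylvester's law of inertia: a positive multiple would match the signatures \<open>(r, s)\<close>
  and \<open>(s, r)\<close>.\<close>

lemma swapped_signature_factor_nonpos: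
  assumes G: "linear_map_on (pseudo_space r s) G" and "r \<noteq> s"
    and c: "\<And>z. z \<in> pseudo_space r s \<Longrightarrow> pseudo_form s r (G z) (G z) = c * pseudo_form r s z z"
  shows "c \<le> 0"
proof (rule ccontr)
  assume "\<not> c \<le> 0"
  then have c0: "c > 0" by simp
  show False
  proof (cases "s < r")
    case True
    \<comment> \<open>\<open>z\<close> has only positive coordinates of signature
      \<open>(r, s)\<close>, while \<open>G z\<close> has lost all \<open>s\<close> positive ones of
      signature \<open>(s, r)\<close>.\<close>
    obtain z where z: "z \<in> pseudo_space r s" "\<exists>j\<in>{..<r}. z j \<noteq> 0" "\<forall>j. j \<notin> {..<r} \<longrightarrow> z j = 0"
      "\<forall>i\<in>{..<s}. (G z) i = 0"
      using exists_vanishing_coordinates[OF G, of "{..<r}" "{..<s}"] True by auto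
    have "pseudo_form r s z z = (\<Sum>i<r. z i * z i)" using z(3) by (simp add: pseudo_form_def)
    moreover have "(\<Sum>i<r. z i * z i) > 0"
      using z(2) by (auto intro!: sum_pos2 simp: zero_less_mult_iff linorder_neq_iff)
    moreover have "pseudo_form s r (G z) (G z) \<le> 0" using z(4) by (simp add: pseudo_form_def sum_nonneg)
    ultimately show False using c[OF z(1)] c0 by (simp add: mult_le_0_iff)
  next
    case False
    then have rs: "r < s" using \<open>r \<noteq> s\<close> by simp
    have sub: "{r..<r+s} \<subseteq> {..<r+s}" by auto
    \<comment> \<open>The mirror image: \<open>z\<close> lives in the \<open>s\<close> negative
      directions and \<open>G z\<close> has lost its \<open>r\<close> negative ones.\<close>
    obtain z where z: "z \<in> pseudo_space r s" "\<exists>j\<in>{r..<r+s}. z j \<noteq> 0" "\<forall>j. j \<notin> {r..<r+s} \<longrightarrow> z j = 0"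
      "\<forall>i\<in>{s..<s+r}. (G z) i = 0"
      using exists_vanishing_coordinates[OF G sub, of "{s..<s+r}"] rs by auto
    obtain j where j: "j < s" "z (r + j) \<noteq> 0"
      using z(2) by (metis add_diff_inverse_nat atLeastLessThan_iff less_diff_conv2 add.commute not_less)
    have "pseudo_form r s z z = - (\<Sum>j<s. z (r + j) * z (r + j))" using z(3) by (simp add: pseudo_form_def)
    moreover have "(\<Sum>j<s. z (r + j) * z (r + j)) > 0"
      using j by (intro sum_pos2[of _ j]) (auto simp: zero_less_mult_iff linorder_neq_iff)
    moreover have "pseudo_form s r (G z) (G z) \<ge> 0" using z(4) by (simp add: pseudo_form_def sum_nonneg)
    ultimately show False using c[OF z(1)] c0 by (simp add: mult_le_0_iff)
  qed
qed

section \<open>The contradiction for swapped signatures\<close>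

theorem not_lie_isomorphic_swapped:
  fixes M :: "'u::real_vector form_module" and M' :: "'v::real_vector form_module"
  assumes r: "r mod 4 = 3" and s: "0 < s" and rs: "r \<noteq> s"
    and min: "minimal_admissible r s M" and M': "admissible s r M'"
  shows "\<not> lie_isomorphic (pseudo_H_type r s M) (pseudo_H_type s r M')"
proof
  assume iso: "lie_isomorphic (pseudo_H_type r s M) (pseudo_H_type s r M')"
  define U where "U = mod_space M"
  define U' where "U' = mod_space M'"
  define B where "B = mod_form M"
  define B' where "B' = mod_form M'"
  define J where "J = cl_act M"
  define J' where "J' = cl_act M'"
  define Z where "Z = pseudo_space r s"
  note defs = U_def U'_def B_def B'_def J_def J'_def Z_def
  have M: "admissible r s M" and Une: "U \<noteq> {0}" using min by (auto simp: minimal_admissible_def U_def)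
  have r0: "0 < r" and odd: "odd r" using r by presburger+
  obtain A G where A: "linear_map_on U A" "A ` U = U'" "\<And>x. x \<in> U \<Longrightarrow> A x = 0 \<Longrightarrow> x = 0"
    and G: "linear_map_on Z G" "\<And>z. z \<in> Z \<Longrightarrow> G z \<in> pseudo_space s r"
    and AG: "\<And>z x y. z \<in> Z \<Longrightarrow> x \<in> U \<Longrightarrow> y \<in> U \<Longrightarrow> B' (J' (G z) (A x)) (A y) = B (J z x) y"
    using lie_isomorphic_intertwines[OF M M' r0 s iso] unfolding defs by blast
  note D = admissibleD[OF M, folded defs] and D' = admissibleD[OF M', folded defs]
  have Am: "A x \<in> U'" if "x \<in> U" for x using A(2) that by blast
  \<comment> \<open>Since \<open>A\<close> is onto, non-degeneracy of \<open>B'\<close> may be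
    tested against the vectors \<open>A y\<close> alone.\<close>
  have ext: "x' = y'" if x': "x' \<in> U'" "y' \<in> U'" and e: "\<And>y. y \<in> U \<Longrightarrow> B' x' (A y) = B' y' (A y)" for x' y'
  proof -
    have m: "- y' \<in> U'" "x' - y' \<in> U'" using D'(1) x' by (auto intro: subspace_neg subspace_diff)
    have "B' (x' - y') y = 0" if y: "y \<in> U'" for y
    proof -
      have "B' (x' + (-1) *\<^sub>R y') y = B' x' y + (-1) * B' y' y"
        using bilinear_onD(3)[OF D'(3) x'(1) y, of "- y'"] bilinear_onD(1)[OF D'(3) x'(2) y, of "-1"] m by simp
      then show ?thesis using y e A(2) by auto
    qed
    then have "x' - y' = 0" using D'(9)[OF m(2)] by blast
    then show ?thesis by simp
  qed
  obtain u where u: "u \<in> U" "u \<noteq> 0" using Une subspace_0[OF D(1)] by blast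
  \<comment> \<open>For null \<open>z\<close> the operator \<open>J z\<close> squares to zero, so
    \<open>u\<close> or \<open>J z u\<close> is a nonzero kernel vector. \<open>A\<close> carries it
    into the kernel of \<open>J' (G z)\<close>, which forces \<open>G z\<close> to be null.\<close>
  have null: "pseudo_form s r (G z) (G z) = 0" if z: "z \<in> Z" "pseudo_form r s z z = 0" for z
  proof -
    have "\<exists>x\<in>U. x \<noteq> 0 \<and> J z x = 0"
      using D(4)[OF z(1) u(1)] D(7)[OF z(1) u(1)] z(2) u by (cases "J z u = 0") auto
    then obtain x where x: "x \<in> U" "x \<noteq> 0" "J z x = 0" by blast
    have 0: "0 \<in> U" "0 \<in> U'" using D(1) D'(1) by (auto intro: subspace_0)
    have "J' (G z) (A x) = 0"
    proof (rule ext[OF D'(4)[OF G(2)[OF z(1)] Am[OF x(1)]] 0(2)])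
      fix y assume y: "y \<in> U"
      have "B 0 y = 0" "B' 0 (A y) = 0"
        using bilinear_onD(1)[OF D(3) 0(1) y, of 0] bilinear_onD(1)[OF D'(3) 0(2) Am[OF y], of 0] by auto
      then show "B' (J' (G z) (A x)) (A y) = B' 0 (A y)" using AG[OF z(1) x(1) y] x(3) by simp
    qed
    moreover have "A x \<noteq> 0" using A(3) x by blast
    ultimately show ?thesis
      using cl_act_eq_0[OF M' G(2)[OF z(1)], of "A x"] Am[OF x(1)] by (auto simp: defs)
  qed
  have bq: "bilinear_on Z (\<lambda>z w. pseudo_form s r (G z) (G w))"
    using G(1) bilinear_onD(1,3)[OF bilinear_on_pseudo_form[of UNIV s r], simplified]
    by (auto simp: bilinear_on_def linear_map_on_def pseudo_form_add pseudo_form_scale)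
  obtain c where c: "\<And>z w. z \<in> Z \<Longrightarrow> w \<in> Z \<Longrightarrow> pseudo_form s r (G z) (G w) = c * pseudo_form r s z w"
    using vanishing_on_null_cone[OF bq[unfolded Z_def]] null pseudo_form_commute r0 s unfolding Z_def
    by (metis (no_types, lifting))
  have e: "unit_vec i \<in> Z" if "i < r + s" for i unfolding Z_def by (rule unit_vec_in_pseudo_space[OF that])
  \<comment> \<open>By \<open>AG\<close>, \<open>J' (G z)\<close> composed with \<open>A\<close> is
    the inverse transpose of \<open>A\<close> composed with \<open>J z\<close>. Applying
    \<open>J' (G z)\<close> twice to \<open>A (J z (J w x))\<close> therefore produces the squares
    of both actions, and their common factor \<open>pseudo_form r s z z\<close> cancels.\<close>
  have eq: "c *\<^sub>R A (J z (J w x)) = J' (G z) (J' (G w) (A x))"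
    if z: "z \<in> Z" and w: "w \<in> Z" and x: "x \<in> U" and nz: "pseudo_form r s z z \<noteq> 0" for z w x
  proof -
    note m = D(4)[OF w x] D(4)[OF z D(4)[OF w x]]
    note m' = Am[OF m(2)] D'(4)[OF G(2)[OF w] Am[OF x]]
    let ?q = "pseudo_form r s z z"
    have s': "- ?q *\<^sub>R J' (G w) (A x) \<in> U'" using D'(1) m' by (blast intro: subspace_scale)
    have "J' (G z) (A (J z (J w x))) = - ?q *\<^sub>R J' (G w) (A x)"
    proof (rule ext[OF D'(4)[OF G(2)[OF z] m'(1)] s'])
      fix y assume y: "y \<in> U"
      have "B' (J' (G z) (A (J z (J w x)))) (A y) = B (- ?q *\<^sub>R J w x) y"
        using AG[OF z m(2) y] D(7)[OF z m(1)] by simp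
      also have "\<dots> = - ?q * B' (J' (G w) (A x)) (A y)"
        using bilinear_onD(1)[OF D(3) m(1) y, of "- ?q"] AG[OF w x y] by simp
      finally show "B' (J' (G z) (A (J z (J w x)))) (A y) = B' (- ?q *\<^sub>R J' (G w) (A x)) (A y)"
        using bilinear_onD(1)[OF D'(3) m'(2) Am[OF y], of "- ?q"] by simp
    qed
    then have "J' (G z) (J' (G z) (A (J z (J w x)))) = - ?q *\<^sub>R J' (G z) (J' (G w) (A x))"
      by (simp only: linear_map_onD(2)[OF D'(5)[OF G(2)[OF z]] m'(2)])
    then have "?q *\<^sub>R (c *\<^sub>R A (J z (J w x))) = ?q *\<^sub>R J' (G z) (J' (G w) (A x))"
      using D'(7)[OF G(2)[OF z] m'(1)] c[OF z z] by (simp add: mult.commute)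
    then show ?thesis by (rule scaleR_left_imp_eq[OF nz])
  qed
  have c_le: "c \<le> 0"
    by (rule swapped_signature_factor_nonpos[OF G(1)[unfolded Z_def] rs]) (use c in \<open>simp add: Z_def\<close>)
  \<comment> \<open>Otherwise \<open>J' (G (unit_vec 0))\<close> squares to zero and has a kernel,
    which \<open>A\<close> pulls back to a kernel of the injective
    \<open>J (unit_vec 0)\<close>.\<close>
  have "c \<noteq> 0"
  proof
    assume "c = 0"
    have e0: "unit_vec 0 \<in> Z" "pseudo_form r s (unit_vec 0) (unit_vec 0) \<noteq> 0"
      using e r0 by (auto simp: pseudo_form_unit_vec)
    have G0: "G (unit_vec 0) \<in> pseudo_space s r" using G(2) e0(1) .
    have Au: "A u \<in> U'" "A u \<noteq> 0" using Am A(3) u by blast+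
    have "J' (G (unit_vec 0)) (J' (G (unit_vec 0)) (A u)) = 0"
      using D'(7)[OF G0 Au(1)] c[OF e0(1) e0(1)] \<open>c = 0\<close> by simp
    then have "\<exists>x'\<in>U'. x' \<noteq> 0 \<and> J' (G (unit_vec 0)) x' = 0"
      using Au D'(4)[OF G0 Au(1)] by blast
    then obtain x where x: "x \<in> U" "A x \<noteq> 0" "J' (G (unit_vec 0)) (A x) = 0" using A(2) by blast
    have 0: "0 \<in> U'" using D'(1) by (rule subspace_0)
    have "B (J (unit_vec 0) x) y = 0" if y: "y \<in> U" for y
      using AG[OF e0(1) x(1) y] x(3) bilinear_onD(1)[OF D'(3) 0 Am[OF y], of 0] by simp
    then have "J (unit_vec 0) x = 0" using D(9)[OF D(4)[OF e0(1) x(1)]] by blast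
    then have "x = 0" using cl_act_eq_0[OF M] e0 x(1) by (auto simp: defs)
    then show False using x(1,2) linear_map_onD(3)[OF A(1)] by blast
  qed
  then have c_neg: "c < 0" using c_le by simp
  define K where "K i = J (unit_vec i)" for i
  define K' where "K' i = J' (G (unit_vec i))" for i
  interpret S: skew_system U B K "r + s" "\<lambda>i. - pseudo_form r s (unit_vec i) (unit_vec i)"
    unfolding defs K_def
    by (rule admissible_skew_system[OF M]) (use e in \<open>auto simp: Z_def pseudo_form_unit_vec\<close>)
  interpret S': skew_system U' B' K' "r + s"
    "\<lambda>i. - pseudo_form s r (G (unit_vec i)) (G (unit_vec i))"
    unfolding defs K'_def
    by (rule admissible_skew_system[OF M']) (use e G(2) c in \<open>auto simp: pseudo_form_unit_vec\<close>)
  \<comment> \<open>Single operators are intertwined through \<open>A\<close> and its inverse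
    transpose, but a product of two through \<open>A\<close> alone, at the cost of one factor
    \<open>c\<close>.\<close>
  have even: "c ^ m *\<^sub>R A (volume K (2 * m) x) = volume K' (2 * m) (A x)"
    if "2 * m \<le> r + s" "x \<in> U" for m x
    using that(1)
  proof (induction m)
    case (Suc m)
    then have i: "2 * m < r + s" "Suc (2 * m) < r + s" "2 * m \<le> r + s" by auto
    let ?v = "volume K (2 * m) x"
    have v: "?v \<in> U" by (rule S.volume_mem[OF i(3) that(2)])
    note Av = Am[OF v] S'.mem[OF i(1) Am[OF v]]
    have "c *\<^sub>R A (K (Suc (2 * m)) (K (2 * m) ?v)) = K' (Suc (2 * m)) (K' (2 * m) (A ?v))"
      using eq[OF e[OF i(2)] e[OF i(1)] v] i(2) by (simp add: K_def K'_def pseudo_form_unit_vec)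
    then have "c ^ m *\<^sub>R (c *\<^sub>R A (K (Suc (2 * m)) (K (2 * m) ?v))) =
        K' (Suc (2 * m)) (K' (2 * m) (c ^ m *\<^sub>R A ?v))"
      using linear_map_onD(2)[OF S'.lin[OF i(1)] Av(1)] linear_map_onD(2)[OF S'.lin[OF i(2)] Av(2)] by simp
    then show ?case using Suc.IH[OF i(3)] by (simp add: mult.commute)
  qed simp
  obtain m where m: "r = Suc (2 * m)" using odd by (metis oddE Suc_eq_plus1)
  have rn: "r \<le> r + s" "2 * m \<le> r + s" "2 * m < r + s" using m by auto
  \<comment> \<open>The volume has one factor beyond the \<open>m\<close> pairs; \<open>AG\<close>
    absorbs it into the form.\<close>
  have pull: "c ^ m * B (volume K r x) x = B' (volume K' r (A x)) (A x)" if x: "x \<in> U" for x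
  proof -
    let ?v = "volume K (2 * m) x"
    have v: "?v \<in> U" by (rule S.volume_mem[OF rn(2) x])
    have "c ^ m * B (volume K r x) x = c ^ m * B' (K' (2 * m) (A ?v)) (A x)"
      using AG[OF e[OF rn(3)] v x] by (simp add: m K_def K'_def)
    also have "\<dots> = B' (K' (2 * m) (c ^ m *\<^sub>R A ?v)) (A x)"
      using linear_map_onD(2)[OF S'.lin[OF rn(3)] Am[OF v]]
        bilinear_onD(1)[OF D'(3) S'.mem[OF rn(3) Am[OF v]] Am[OF x]] by simp
    finally show ?thesis using even[OF rn(2) x] by (simp add: m)
  qed
  have n0: "0 < r + s" using r0 by simp
  have e0: "pseudo_form s r (G (unit_vec 0)) (G (unit_vec 0)) = c"
    using c[OF e e] r0 by (simp add: pseudo_form_unit_vec)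
  \<comment> \<open>\<open>K' 0\<close> commutes with the odd product containing it; skewness gives
    -1 and the square gives \<open>- c\<close>.\<close>
  have twist: "B' (volume K' r (K' 0 x)) (K' 0 x) = c * B' (volume K' r x) x" if x: "x \<in> U'" for x
  proof -
    note v = S'.volume_mem[OF rn(1) x] S'.mem[OF n0 x]
    have "volume K' r (K' 0 x) = K' 0 (volume K' r x)"
      using S'.volume_commute[OF rn(1) n0 x] r0 odd by simp
    then have "B' (volume K' r (K' 0 x)) (K' 0 x) = - B' (volume K' r x) (K' 0 (K' 0 x))"
      using S'.skew[OF n0 v] by simp
    also have "K' 0 (K' 0 x) = (- c) *\<^sub>R x" using S'.sq[OF n0 x] e0 by simp
    finally show ?thesis using bilinear_onD(2)[OF D'(3) x v(1), of "- c"] by simp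
  qed
  obtain l where l: "\<And>x. x \<in> U \<Longrightarrow> x \<noteq> 0 \<Longrightarrow> l * B (volume K r x) x > 0"
    using minimal_admissible_volume_form_definite[OF min r] by (auto simp: defs K_def[abs_def])
  \<comment> \<open>Through \<open>A\<close>, passing from \<open>u\<close> to \<open>y\<close> is
    the action of \<open>K' 0\<close>, so the volume form on \<open>y\<close> is \<open>c\<close>
    times its value on \<open>u\<close> and has the opposite sign.\<close>
  obtain y where y: "y \<in> U" "A y = K' 0 (A u)" using S'.mem[OF n0 Am[OF u(1)]] A(2) by (metis imageE)
  have "y \<noteq> 0"
  proof
    assume "y = 0"
    then have "K' 0 (A u) = 0" using y linear_map_onD(3)[OF A(1)] by simp
    then show False using S'.J_eq_0[OF n0 _ Am[OF u(1)]] e0 c_neg A(3) u by auto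
  qed
  have "c ^ m * B (volume K r y) y = c ^ m * (c * B (volume K r u) u)"
    using pull[OF y(1)] pull[OF u(1)] twist[OF Am[OF u(1)]] y(2) by (simp add: mult_ac)
  then have "B (volume K r y) y = c * B (volume K r u) u" using c_neg by simp
  then have "l * B (volume K r y) y = c * (l * B (volume K r u) u)" by simp
  also have "\<dots> < 0" by (rule mult_neg_pos[OF c_neg l[OF u]])
  finally show False using l[OF y(1) \<open>y \<noteq> 0\<close>] by simp
qed

text \<open>In each family the first index is 3 modulo 4 and the second is positive. The two indices
  always differ in the first two families; in the third, (3, 11) with \<open>k = 1\<close> gives
  signature (11, 11) on both sides, which is why \<open>r + 8 * k \<noteq> s\<close> is
  required.\<close>

theorem theorem10:
  fixes r s :: nat
  assumes "(r, s) \<in> {(3, 1), (3, 2), (3, 7), (3, 11)}"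
  shows
    "(\<forall>k (M :: 'u::real_vector form_module) (M' :: 'v::real_vector form_module).
        minimal_admissible (r + 4 * k) (s + 4 * k) M \<longrightarrow>
        minimal_admissible (s + 4 * k) (r + 4 * k) M' \<longrightarrow>
        \<not> lie_isomorphic (pseudo_H_type (r + 4 * k) (s + 4 * k) M)
                         (pseudo_H_type (s + 4 * k) (r + 4 * k) M')) \<and>
     (\<forall>k (M :: 'u::real_vector form_module) (M' :: 'v::real_vector form_module).
        minimal_admissible r (s + 8 * k) M \<longrightarrow>
        minimal_admissible (s + 8 * k) r M' \<longrightarrow>
        \<not> lie_isomorphic (pseudo_H_type r (s + 8 * k) M)
                         (pseudo_H_type (s + 8 * k) r M')) \<and>
     (\<forall>k (M :: 'u::real_vector form_module) (M' :: 'v::real_vector form_module).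
        r + 8 * k \<noteq> s \<longrightarrow>
        minimal_admissible (r + 8 * k) s M \<longrightarrow>
        minimal_admissible s (r + 8 * k) M' \<longrightarrow>
        \<not> lie_isomorphic (pseudo_H_type (r + 8 * k) s M)
                         (pseudo_H_type s (r + 8 * k) M'))"
proof -
  have main: "\<not> lie_isomorphic (pseudo_H_type a b M) (pseudo_H_type b a M')"
    if "minimal_admissible a b M" "minimal_admissible b a M'" "a mod 4 = 3" "0 < b" "a \<noteq> b"
    for a b and M :: "'u form_module" and M' :: "'v form_module"
    using not_lie_isomorphic_swapped[of a b M M'] that by (simp add: minimal_admissible_def)
  have r: "r = 3" and s: "s = 1 \<or> s = 2 \<or> s = 7 \<or> s = 11" using assms by auto
  have k: "(3 + 4 * k) mod 4 = 3" "(3 + 8 * k) mod 4 = 3" "(3::nat) mod 4 = 3" for k :: nat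
    by presburger+
  have "0 < s" "r \<noteq> s" "r \<noteq> s + 8 * k" for k using r s by auto
  then show ?thesis using r k by (intro conjI allI impI main) auto
qed

end
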